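(* Let $d\ge 2$ be an integer and let $0<r<1/2$ be fixed. Let $(\varepsilon_M)_{M\ge 2}$ be a sequence of real numbers with $M^{-1}<\varepsilon_M<1$ for every $M$. Then there exist a sequence $(\mu_M)_{M\ge2}$ of (Borel) probability measures on $\mathbb{T}^d$, each $\mu_M$ being supported in a ball of radius $\varepsilon_M$, and a constant $c>0$ independent of $M$, such that for every $M\ge2$, with $N=M^d$, $$D^2_{\mu_M}(N)\le cN^{1-1/d}.$$
   Context: The torus $\mathbb{T}^d=\mathbb{R}^d/\mathbb{Z}^d$ is identified with the cube $Q=[-1/2,1/2)^d$; $B=\{t\in\mathbb{R}^d:|t|\le 1\}$ is the Euclidean unit ball, $|B|$ its volume, and $0<r<1/2$ is a fixed radius. For $t\in\mathbb{T}^d$, the set $rB-t$ is regarded as a subset of $\mathbb{T}^d$ (so $\chi_{rB-t}(v)=1$ if $v+t\in rB$ modulo $\mathbb{Z}^d$, and $0$ otherwise). A ball of radius $\varepsilon$ in $\mathbb{T}^d$ is the image of a Euclidean ball of radius $\varepsilon$ in $\mathbb{R}^d$. For a positive integer $M$ put $N=M^d$ and let $T_N=\{t_j\}_{j=1}^N=\frac1M\mathbb{Z}^d\cap Q$. Given a probability measure $\mu$ on $\mathbb{T}^d$, let $\mu_j$ ($j=1,\dots,N$) be the translated measure defined by $\int_{\mathbb{T}^d} g(t)\,d\mu_j(t)=\int_{\mathbb{T}^d} g(t-t_j)\,d\mu(t)$ for every continuous $g$ on $\mathbb{T}^d$. For points $V_N=\{v_1,\dots,v_N\}$ in $\mathbb{T}^d$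 (repetitions counted) define the discrepancy function $$D_{V_N}(t)=\sum_{j=1}^N\chi_{rB-t}(v_j)-Nr^d|B|,\qquad t\in\mathbb{T}^d,$$ and define the generalized discrepancy $$D_\mu(N)=\left\{\int_{\mathbb{T}^d}\cdots\int_{\mathbb{T}^d}\int_{\mathbb{T}^d}D_{V_N}^2(t)\,dt\,d\mu_1(v_1)\cdots d\mu_N(v_N)\right\}^{1/2}.$$ In $D_{\mu_M}(N)$ this definition is applied with $\mu$ equal to the $M$-th measure of the sequence and $N=M^d$ (the subscript $M$ indexes the sequence and does not denote a translate). *)

theory Defs
  imports "HOL-Probability.Probability"
begin

text \<open>
  The torus of dimension \<open>d = CARD('n)\<close> is represented by the half-open cube
  \<open>[-1/2, 1/2)\<^sup>d\<close>, a fundamental domain for the integer lattice. The quotient map becomes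
  \<open>torus_rep\<close>, which sends a vector to its representative in the cube. The identification is
  an isomorphism of measurable spaces, so Borel measures on the torus are the measures on the
  Borel sets of the cube.
\<close>

definition torus :: "(real ^ 'n) set" where
  "torus = {x. \<forall>i. - 1 / 2 \<le> x $ i \<and> x $ i < 1 / 2}"

definition int_lattice :: "(real ^ 'n) set" where
  "int_lattice = {k. \<forall>i. k $ i \<in> \<int>}"

definition torus_rep :: "real ^ 'n \<Rightarrow> real ^ 'n" where
  "torus_rep x = (\<chi> i. x $ i - of_int \<lfloor>x $ i + 1 / 2\<rfloor>)"

definition torus_borel :: "(real ^ 'n::finite) measure" where
  "torus_borel = restrict_space borel torus"

definition torus_lebesgue :: "(real ^ 'n::finite) measure" where
  "torus_lebesgue = restrict_space lborel torus"

definition torus_ball :: "real ^ 'n::finite \<Rightarrow> real \<Rightarrow> (real ^ 'n) set" where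
  "torus_ball x \<epsilon> = torus_rep ` cball x \<epsilon>"

definition torus_prob_measure :: "(real ^ 'n::finite) measure \<Rightarrow> bool" where
  "torus_prob_measure \<mu> \<longleftrightarrow> prob_space \<mu> \<and> sets \<mu> = sets torus_borel"

text \<open>
  A torus ball is the image of a compact set, hence closed in the quotient topology. Thus
  having full measure is the same as containing the closed support of the measure.
\<close>

definition supported_in_ball :: "real \<Rightarrow> (real ^ 'n::finite) measure \<Rightarrow> bool" where
  "supported_in_ball \<epsilon> \<mu> \<longleftrightarrow> (\<exists>x. AE v in \<mu>. v \<in> torus_ball x \<epsilon>)"

definition torus_translate :: "real ^ 'n::finite \<Rightarrow> (real ^ 'n) measure \<Rightarrow> (real ^ 'n) measure" where
  "torus_translate s \<mu> = distr \<mu> torus_borel (\<lambda>v. torus_rep (v - s))"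

definition grid :: "nat \<Rightarrow> (real ^ 'n) set" where
  "grid M = (\<lambda>k. (1 / real M) *\<^sub>R k) ` int_lattice \<inter> torus"

text \<open>
  The points are a family \<open>V\<close> over a finite index set \<open>I\<close>, so repeated points are counted.
  The set \<open>rB - t\<close> is the Euclidean ball of radius \<open>r\<close> about \<open>- t\<close>, taken modulo the lattice.
\<close>

definition discrepancy ::
    "real \<Rightarrow> 'i set \<Rightarrow> ('i \<Rightarrow> real ^ 'n::finite) \<Rightarrow> real ^ 'n \<Rightarrow> real" where
  "discrepancy r I V t =
     (\<Sum>j\<in>I. indicator (torus_ball (- t) r) (V j))
       - real (card I) * r ^ CARD('n) * measure lborel (cball 0 1 :: (real ^ 'n) set)"

text \<open>
  The random points are indexed by the grid points themselves: the point with index \<open>s\<close> has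
  law \<open>torus_translate s \<mu>\<close>, and the iterated integral over all points is the integral
  with respect to the product measure. The number of points is \<open>M ^ CARD('n)\<close>
  (lemma \<open>card_grid\<close> below).
\<close>

definition gen_discrepancy :: "real \<Rightarrow> nat \<Rightarrow> (real ^ 'n::finite) measure \<Rightarrow> real" where
  "gen_discrepancy r M \<mu> =
     sqrt (\<integral>V. (\<integral>t. (discrepancy r (grid M) V t)\<^sup>2 \<partial>torus_lebesgue)
             \<partial>(Pi\<^sub>M (grid M) (\<lambda>s. torus_translate s \<mu>)))"

lemma torus_rep_in_torus: "torus_rep x \<in> torus"
proof -
  have "- 1 / 2 \<le> a - of_int \<lfloor>a + 1 / 2\<rfloor> \<and> a - of_int \<lfloor>a + 1 / 2\<rfloor> < 1 / 2" for a :: real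
    by linarith
  then show ?thesis by (simp add: torus_def torus_rep_def)
qed

lemma torus_rep_diff_int_lattice: "torus_rep x - x \<in> int_lattice"
  by (simp add: torus_rep_def int_lattice_def)

lemma torus_rep_eqI:
  assumes "y \<in> torus" "y - x \<in> int_lattice"
  shows "torus_rep x = y"
proof (rule vec_eq_iff[THEN iffD2], rule allI)
  fix i
  obtain k where k: "y $ i - x $ i = of_int k"
    using assms(2) by (auto simp: int_lattice_def elim!: Ints_cases)
  have "\<lfloor>x $ i + 1 / 2\<rfloor> = - k"
    using assms(1) k by (intro floor_unique) (auto simp: torus_def dest!: spec[of _ i])
  then show "torus_rep x $ i = y $ i" using k by (simp add: torus_rep_def)
qed

lemma mem_torus_ball_uminus_iff:
  assumes "v \<in> torus"
  shows "v \<in> torus_ball (- t) r \<longleftrightarrow> (\<exists>k\<in>int_lattice. norm (v + t + k) \<le> r)"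
proof
  assume "v \<in> torus_ball (- t) r"
  then obtain y where y: "v = torus_rep y" "dist (- t) y \<le> r"
    by (auto simp: torus_ball_def)
  have "dist (- t) y = norm (y + t)" by (subst dist_commute) (simp add: dist_norm)
  with y(2) have le: "norm (y + t) \<le> r" by simp
  have "y - v \<in> int_lattice"
    by (simp add: y(1) torus_rep_def int_lattice_def)
  moreover have "v + t + (y - v) = y + t" by simp
  ultimately show "\<exists>k\<in>int_lattice. norm (v + t + k) \<le> r" using le by (intro bexI[of _ "y - v"]) (simp_all add: add_ac)
next
  assume "\<exists>k\<in>int_lattice. norm (v + t + k) \<le> r"
  then obtain k where k: "k \<in> int_lattice" "norm (v + t + k) \<le> r" by blast
  have "v - (v + k) \<in> int_lattice" using k(1) by (simp add: int_lattice_def)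
  then have "torus_rep (v + k) = v" using assms by (rule torus_rep_eqI[rotated])
  moreover have "dist (- t) (v + k) = norm (v + t + k)"
    by (subst dist_commute) (simp add: dist_norm add_ac)
  ultimately show "v \<in> torus_ball (- t) r"
    unfolding torus_ball_def using k(2) by (intro image_eqI[of _ _ "v + k"]) simp_all
qed

lemma torus_rep_measurable: "torus_rep \<in> borel \<rightarrow>\<^sub>M (torus_borel :: (real ^ 'n::finite) measure)"
proof -
  have *: "(\<lambda>x :: real ^ 'n. x $ i) \<in> borel_measurable borel" for i
    by (intro borel_measurable_continuous_onI continuous_intros)
  have "(torus_rep :: real ^ 'n \<Rightarrow> real ^ 'n) \<in> borel_measurable borel"
    unfolding borel_measurable_euclidean_space[of torus_rep]
  proof (rule ballI)
    fix b :: "real ^ 'n" assume "b \<in> Basis"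
    then obtain i where b: "b = axis i 1" by (auto simp: Basis_vec_def)
    show "(\<lambda>x :: real ^ 'n. torus_rep x \<bullet> b) \<in> borel_measurable borel"
      unfolding b inner_axis torus_rep_def using *[of i] by simp
  qed
  then show ?thesis
    unfolding torus_borel_def by (intro measurable_restrict_space2) (auto simp: torus_rep_in_torus)
qed

lemma integral_torus_translate:
  fixes G :: "real ^ 'n::finite \<Rightarrow> real"
  assumes \<mu>: "torus_prob_measure \<mu>" and G: "continuous_on UNIV G"
    and per: "\<And>x k. k \<in> int_lattice \<Longrightarrow> G (x + k) = G x"
  shows "(\<integral>v. G v \<partial>torus_translate s \<mu>) = (\<integral>v. G (v - s) \<partial>\<mu>)"
proof -
  have "(\<lambda>v. v - s) \<in> torus_borel \<rightarrow>\<^sub>M borel"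
    unfolding torus_borel_def
    by (intro measurable_restrict_space1 borel_measurable_continuous_onI continuous_intros)
  then have "(\<lambda>v. v - s) \<in> \<mu> \<rightarrow>\<^sub>M borel"
    using \<mu> measurable_cong_sets[of \<mu> torus_borel] by (auto simp: torus_prob_measure_def)
  from measurable_compose[OF this torus_rep_measurable]
  have m: "(\<lambda>v. torus_rep (v - s)) \<in> \<mu> \<rightarrow>\<^sub>M torus_borel" .
  have "G \<in> borel_measurable torus_borel"
    unfolding torus_borel_def
    using G by (intro measurable_restrict_space1 borel_measurable_continuous_onI)
  then have "(\<integral>v. G v \<partial>torus_translate s \<mu>) = (\<integral>v. G (torus_rep (v - s)) \<partial>\<mu>)"
    unfolding torus_translate_def by (rule integral_distr[OF m])
  moreover have "G (torus_rep x) = G x" for x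
    using per[OF torus_rep_diff_int_lattice[of x], of x] by simp
  ultimately show ?thesis by simp
qed

lemma card_grid:
  assumes "M > 0"
  shows "card (grid M :: (real ^ 'n::finite) set) = M ^ CARD('n)"
proof -
  define K where "K = {\<lceil>- real M / 2\<rceil> ..< \<lceil>- real M / 2\<rceil> + int M}"
  define S where "S = (\<lambda>k. of_int k / real M) ` K"
  have inK: "k \<in> K \<longleftrightarrow> - 1 / 2 \<le> of_int k / real M \<and> of_int k / real M < 1 / 2" for k
  proof -
    have "k \<in> K \<longleftrightarrow> \<lceil>- real M / 2\<rceil> \<le> k \<and> k < \<lceil>real M / 2\<rceil>"
      using ceiling_add_of_int[of "- real M / 2" "int M"] by (simp add: K_def)
    also have "\<dots> \<longleftrightarrow> - real M / 2 \<le> of_int k \<and> of_int k < real M / 2"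
      by (simp add: ceiling_le_iff less_ceiling_iff)
    finally show ?thesis using assms by (simp add: field_simps)
  qed
  have "card S = M"
    unfolding S_def using assms by (subst card_image) (auto simp: inj_on_def K_def)
  have "(grid M :: (real ^ 'n) set) = {x. \<forall>i. x $ i \<in> S}"
  proof (intro set_eqI iffI)
    fix x :: "real ^ 'n" assume "x \<in> grid M"
    then obtain k where k: "x = (1 / real M) *\<^sub>R k" "k \<in> int_lattice" "x \<in> torus"
      by (auto simp: grid_def)
    show "x \<in> {x. \<forall>i. x $ i \<in> S}"
    proof (rule CollectI, rule allI)
      fix i
      obtain j where j: "k $ i = of_int j"
        using k(2) by (auto simp: int_lattice_def elim!: Ints_cases)
      have "- 1 / 2 \<le> x $ i \<and> x $ i < 1 / 2" using k(3) unfolding torus_def by blast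
      then show "x $ i \<in> S" using k(1) j inK[of j] by (auto simp: S_def)
    qed
  next
    fix x :: "real ^ 'n" assume "x \<in> {x. \<forall>i. x $ i \<in> S}"
    then have "\<forall>i. \<exists>k\<in>K. x $ i = of_int k / real M" by (auto simp: S_def)
    then obtain k where k: "\<And>i. k i \<in> K" "\<And>i. x $ i = of_int (k i) / real M" by metis
    have "x = (1 / real M) *\<^sub>R (\<chi> i. of_int (k i))" by (simp add: vec_eq_iff k(2))
    moreover have "(\<chi> i. of_int (k i)) \<in> int_lattice" by (simp add: int_lattice_def)
    moreover have "x \<in> torus" unfolding torus_def using k inK by auto
    ultimately show "x \<in> grid M" by (auto simp: grid_def)
  qed
  also have "\<dots> = vec_lambda ` (UNIV \<rightarrow>\<^sub>E S)"
  proof (intro set_eqI iffI)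
    fix x :: "real ^ 'n" assume "x \<in> {x. \<forall>i. x $ i \<in> S}"
    then have "vec_nth x \<in> UNIV \<rightarrow>\<^sub>E S" by auto
    then have "vec_lambda (vec_nth x) \<in> vec_lambda ` (UNIV \<rightarrow>\<^sub>E S)" by (rule imageI)
    then show "x \<in> vec_lambda ` (UNIV \<rightarrow>\<^sub>E S)" by simp
  qed auto
  also have "card \<dots> = card (UNIV \<rightarrow>\<^sub>E S :: ('n \<Rightarrow> real) set)"
    by (intro card_image inj_onI) (simp add: vec_lambda_inject)
  also have "\<dots> = M ^ CARD('n)" by (simp add: card_PiE \<open>card S = M\<close>)
  finally show ?thesis .
qed

end

theory Submission
  imports Defs
begin

text \<open>
  Every \<open>\<mu>\<^sub>M\<close> can be the unit mass at the origin. Its translates are unit masses at the points of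
  the grid \<open>(1/M)\<int>\<^sup>d\<close>, so nothing is random, and the generalized discrepancy is the \<open>L\<^sup>2\<close> norm of
  the discrepancy \<open>D(t)\<close> of the \<open>N = M\<^sup>d\<close> grid points with respect to the balls \<open>rB - t\<close>. What has to
  be shown is Kendall's bound for the lattice points in a shifted ball: \<open>\<integral> D\<^sup>2 = O(M\<^sup>d\<^sup>-\<^sup>1)\<close>.

  The Fourier coefficient of \<open>D\<close> at the frequency \<open>k\<close> is zero at \<open>k = 0\<close>, because the mean of \<open>D\<close> is
  subtracted, and zero unless \<open>M\<close> divides every coordinate of \<open>k\<close>, because \<open>D\<close> is invariant under
  shifts by grid points. For the remaining frequencies its modulus is at most \<open>N\<close> times the
  modulus of the Fourier transform of the ball \<open>rB\<close> at \<open>k\<close>, and this is \<open>O(\<bar>k\<bar>\<^sup>-\<^sup>(\<^sup>d\<^sup>+\<^sup>1\<^sup>)\<^sup>/\<^sup>2)\<close>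
  (\<open>ball_fourier_decay\<close>). Summing squares over \<open>k = Mm\<close> gives
  \<open>M\<^sup>2\<^sup>d\<^sup>-\<^sup>d\<^sup>-\<^sup>1 \<Sum> \<bar>m\<bar>\<^sup>-\<^sup>d\<^sup>-\<^sup>1 = O(M\<^sup>d\<^sup>-\<^sup>1)\<close> (\<open>grid_discrepancy_L2\<close>).

  Three facts carry this. The decay of the transform of the ball: by rotation and slicing, the
  transform is the integral of \<open>cos\<^sup>d t\<close> against \<open>exp(i\<lambda> sin t)\<close>, in which the factor \<open>cos\<^sup>d t\<close>
  vanishes at the critical points of the phase; each integration by parts lowers the exponent
  by two and gains a factor \<open>1/\<lambda>\<close> (\<open>osc_decay\<close>). The inequality \<open>\<integral> h\<^sup>2 \<le> sup \<Sum> \<bar>c\<^sub>k\<bar>\<^sup>2\<close>, the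
  supremum over finite sets of frequencies, for a bounded periodic function \<open>h\<close> that is
  continuous almost everywhere: \<open>\<integral> h\<^sup>2\<close> is the limit of the integrals of \<open>h\<close> times its Fejer
  means, and each of these is an average of finite sums of the \<open>\<bar>c\<^sub>k\<bar>\<^sup>2\<close> (\<open>fourier_norm_le\<close>). And the convergence of the lattice
  sum, by comparison with a product of one-dimensional sums
  (\<open>int_vec_norm_powr_sums_bounded\<close>).
\<close>

section \<open>Oscillatory integrals with phase \<open>sin\<close>\<close>

text \<open>
  Even and odd refer to the parity of the amplitude. Up to factors depending on \<open>m\<close> and powers of
  \<open>\<lambda>\<close>, these integrals are Bessel functions of integral and half-integral order.
\<close>

definition osc_even :: "nat \<Rightarrow> real \<Rightarrow> complex" where
  "osc_even m l = integral {-(pi/2)..pi/2} (\<lambda>t. of_real (cos t ^ m) * cis (l * sin t))"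

definition osc_odd :: "nat \<Rightarrow> real \<Rightarrow> complex" where
  "osc_odd m l = integral {-(pi/2)..pi/2} (\<lambda>t. of_real (cos t ^ m * sin t) * cis (l * sin t))"

lemma cis_sin_vector_derivative:
  "((\<lambda>t. cis (l * sin t)) has_vector_derivative (\<i> * of_real (l * cos t) * cis (l * sin t))) (at t within S)"
  unfolding has_vector_derivative_def
  by (rule derivative_eq_intros refl)+
     (auto simp: fun_eq_iff scaleR_conv_of_real field_simps)

text \<open>
  Since \<open>i\<lambda> cos t exp(i\<lambda> sin t)\<close> is the derivative of \<open>exp(i\<lambda> sin t)\<close>, an amplitude with a factor
  \<open>cos t\<close> can be integrated by parts, at a gain of one factor \<open>\<lambda>\<close>.
\<close>

lemma osc_by_parts:
  fixes g g' :: "real \<Rightarrow> real"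
  assumes "a \<le> b"
    and g: "\<And>t. t \<in> {a..b} \<Longrightarrow> (g has_real_derivative g' t) (at t)"
    and cg: "continuous_on {a..b} g'"
  shows "\<i> * of_real l * integral {a..b} (\<lambda>t. of_real (g t * cos t) * cis (l * sin t))
     = of_real (g b) * cis (l * sin b) - of_real (g a) * cis (l * sin a)
       - integral {a..b} (\<lambda>t. of_real (g' t) * cis (l * sin t))"
proof -
  have cgg: "continuous_on {a..b} g"
    using g by (intro continuous_at_imp_continuous_on) (blast intro: DERIV_isCont)
  let ?F = "\<lambda>t. of_real (g t) * cis (l * sin t)"
  let ?A = "\<lambda>t. \<i> * of_real l * (of_real (g t * cos t) * cis (l * sin t))"
  let ?B = "\<lambda>t. of_real (g' t) * cis (l * sin t)"
  have "(?F has_vector_derivative (?A t + ?B t)) (at t within {a..b})" if "t \<in> {a..b}" for t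
  proof -
    have "((\<lambda>t. complex_of_real (g t)) has_vector_derivative of_real (g' t)) (at t within {a..b})"
      using g[OF that] has_vector_derivative_of_real
      by (metis has_field_derivative_at_within)
    from has_vector_derivative_mult[OF this cis_sin_vector_derivative]
    show ?thesis by (rule has_vector_derivative_eq_rhs) (simp add: algebra_simps)
  qed
  then have "((\<lambda>t. ?A t + ?B t) has_integral (?F b - ?F a)) {a..b}"
    by (intro fundamental_theorem_of_calculus assms(1))
  then have "integral {a..b} (\<lambda>t. ?A t + ?B t) = ?F b - ?F a" by (rule integral_unique)
  moreover have "?A integrable_on {a..b}" "?B integrable_on {a..b}"
    by (intro integrable_continuous_interval continuous_intros cgg cg)+
  ultimately have "integral {a..b} ?A + integral {a..b} ?B = ?F b - ?F a"
    by (simp add: integral_add)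
  then show ?thesis by (simp add: algebra_simps)
qed

text \<open>
  In the next two identities the boundary terms vanish because the amplitudes contain a power of
  \<open>cos t\<close>, which is zero at \<open>\<plusminus>\<pi>/2\<close>.
\<close>

lemma osc_even_recurrence:
  "\<i> * of_real l * osc_even (m + 2) l = of_nat (m + 1) * osc_odd m l"
proof -
  have *: "((\<lambda>t. cos t ^ (m+1)) has_real_derivative - (real (m+1) * (cos t ^ m * sin t))) (at t)" for t
    by (rule derivative_eq_intros refl)+ simp
  have "\<i> * of_real l * osc_even (m + 2) l =
     - integral {-(pi/2)..pi/2} (\<lambda>t. of_real (- (real (m+1) * (cos t ^ m * sin t))) * cis (l * sin t))"
    unfolding osc_even_def
    using osc_by_parts[where l = l, OF _ *, of "-(pi/2)" "pi/2"]
    by (simp add: continuous_intros mult_ac)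
  also have "\<dots> = of_nat (m + 1) * osc_odd m l"
    unfolding osc_odd_def by (subst integral_neg [symmetric], subst integral_mult_right [symmetric]) (simp add: algebra_simps)
  finally show ?thesis .
qed

lemma osc_odd_recurrence:
  "\<i> * of_real l * osc_odd (m + 2) l
     = of_nat (m + 1) * osc_even m l - of_nat (m + 2) * osc_even (m + 2) l"
proof -
  let ?g' = "\<lambda>t. of_nat (m+2) * cos t ^ (m + 2) - of_nat (m+1) * cos t ^ m"
  have *: "((\<lambda>t. cos t ^ (m+1) * sin t) has_real_derivative ?g' t) (at t)" for t
  proof -
    have "(sin t)\<^sup>2 = 1 - (cos t)\<^sup>2" by (simp add: sin_squared_eq)
    then have s: "sin t * sin t * x = x - cos t * cos t * x" for x
      by (simp add: power2_eq_square left_diff_distrib)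
    show ?thesis
      by (rule derivative_eq_intros refl)+ (use s[of "cos t ^ m"] s[of "real m * cos t ^ m"] in \<open>simp add: algebra_simps\<close>)
  qed
  have "\<i> * of_real l * osc_odd (m + 2) l =
     - integral {-(pi/2)..pi/2} (\<lambda>t. of_real (?g' t) * cis (l * sin t))"
    unfolding osc_odd_def
    using osc_by_parts[where l = l, OF _ *, of "-(pi/2)" "pi/2"]
    by (simp add: continuous_intros mult_ac)
  also have "(\<lambda>t. of_real (?g' t) * cis (l * sin t)) =
     (\<lambda>t. of_nat (m+2) * (of_real (cos t ^ (m+2)) * cis (l * sin t)) -
          of_nat (m+1) * (of_real (cos t ^ m) * cis (l * sin t)))"
    by (simp add: fun_eq_iff algebra_simps)
  also have "integral {-(pi/2)..pi/2} \<dots> = of_nat (m+2) * osc_even (m+2) l - of_nat (m+1) * osc_even m l"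
    unfolding osc_even_def
    by (subst integral_diff, (intro integrable_continuous_interval continuous_intros)+)
       (simp only: integral_mult_right)
  finally show ?thesis by simp
qed

text \<open>
  A weak form of Jordan's inequality; the optimal constant would be \<open>2/\<pi>\<close>.
\<close>

lemma half_le_sin:
  fixes x :: real
  assumes "0 \<le> x" "x \<le> pi / 2"
  shows "x / 2 \<le> sin x"
proof (cases "x \<le> pi / 3")
  case True
  have "sin 0 - 0 / 2 \<le> sin x - x / 2"
  proof (rule DERIV_nonneg_imp_nondecreasing[OF assms(1)])
    fix t assume t: "0 \<le> t" "t \<le> x"
    have "1 / 2 \<le> cos t"
      using t True cos_60 by (subst cos_60[symmetric], intro cos_monotone_0_pi_le) auto
    moreover have "((\<lambda>t. sin t - t / 2) has_real_derivative cos t - 1 / 2) (at t)"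
      by (auto intro!: derivative_eq_intros)
    ultimately show "\<exists>y. ((\<lambda>t. sin t - t / 2) has_real_derivative y) (at t) \<and> 0 \<le> y" by auto
  qed
  then show ?thesis by simp
next
  case False
  have "x / 2 \<le> 4 / 5" using assms pi_approx by (simp add: field_simps)
  also have "(4 / 5 :: real) \<le> sqrt 3 / 2"
    using real_le_rsqrt[of "8/5" 3] by (simp add: power2_eq_square)
  also have "\<dots> \<le> sin x"
    using False assms by (subst sin_60[symmetric], intro sin_monotone_2pi_le) auto
  finally show ?thesis .
qed

text \<open>
  The phase \<open>sin\<close> has its critical points at the two end points. On intervals of length
  \<open>\<delta> = \<lambda>\<^sup>-\<^sup>1\<^sup>/\<^sup>2\<close> next to them the integrand is bounded trivially. In between, \<open>cos t \<ge> \<delta>/2\<close>, and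
  integration by parts after division by \<open>cos t\<close> costs \<open>O(1/(\<lambda>\<delta>)) = O(\<delta>)\<close>.
\<close>

lemma osc_stationary_bound:
  fixes g g' :: "real \<Rightarrow> real"
  assumes g: "\<And>t. (g has_real_derivative g' t) (at t)" and cg: "continuous_on UNIV g'"
    and b: "\<And>t. \<bar>g t\<bar> \<le> 1" "\<And>t. \<bar>g' t\<bar> \<le> 1" and l: "l \<ge> 1"
  shows "norm (integral {-(pi/2)..pi/2} (\<lambda>t. of_real (g t) * cis (l * sin t))) \<le> 14 * l powr (-1/2)"
proof -
  define \<delta> where "\<delta> = l powr (-1/2)"
  define a where "a = pi/2 - \<delta>"
  have \<delta>: "0 < \<delta>" "\<delta> \<le> 1" using l powr_mono[of "-1/2" 0 l] by (auto simp: \<delta>_def)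
  have l\<delta>: "l * \<delta> = 1 / \<delta>"
    using l unfolding \<delta>_def by (simp add: powr_minus powr_half_sqrt field_simps)
  have a: "0 < a" "a < pi/2" using \<delta> pi_gt3 by (auto simp: a_def)
  let ?f = "\<lambda>t. of_real (g t) * cis (l * sin t)"
  let ?I = "\<lambda>S. integral S ?f"
  have cong: "continuous_on UNIV g" using g by (meson DERIV_isCont continuous_at_imp_continuous_on)
  have cont: "continuous_on S ?f" for S
    by (intro continuous_intros continuous_on_subset[OF cong]) auto
  have int: "?f integrable_on {x..y}" for x y by (intro integrable_continuous_interval cont)
  have bnd: "norm (?I {x..y}) \<le> y - x" if "x \<le> y" for x y
    using integral_bound[OF that cont, of 1] b by (simp add: norm_mult)
  have "?I {-(pi/2)..-a} + ?I {-a..pi/2} = ?I {-(pi/2)..pi/2}"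
    using a by (intro Henstock_Kurzweil_Integration.integral_combine int) auto
  moreover have "?I {-a..a} + ?I {a..pi/2} = ?I {-a..pi/2}"
    using a by (intro Henstock_Kurzweil_Integration.integral_combine int) auto
  ultimately have "?I {-(pi/2)..pi/2} = ?I {-(pi/2)..-a} + ?I {-a..a} + ?I {a..pi/2}"
    by (simp add: add.assoc)
  then have split: "norm (?I {-(pi/2)..pi/2}) \<le> 2 * \<delta> + norm (?I {-a..a})"
    using norm_triangle_ineq[of "?I {-(pi/2)..-a} + ?I {-a..a}" "?I {a..pi/2}"]
      norm_triangle_ineq[of "?I {-(pi/2)..-a}" "?I {-a..a}"]
      bnd[of "-(pi/2)" "-a"] bnd[of a "pi/2"] a by (simp add: a_def)
  have cospos: "cos t > 0" if "t \<in> {-a..a}" for t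
    using that a by (intro cos_gt_zero_pi) auto
  define h' where "h' = (\<lambda>t. (g' t * cos t + g t * sin t) / (cos t)\<^sup>2)"
  have h: "((\<lambda>t. g t / cos t) has_real_derivative h' t) (at t)" if "t \<in> {-a..a}" for t
    unfolding h'_def using cospos[OF that]
    by (auto intro!: derivative_eq_intros g simp: power2_eq_square)
  have ch: "continuous_on {-a..a} h'" unfolding h'_def
    using cospos by (intro continuous_intros continuous_on_subset[OF cong] continuous_on_subset[OF cg])
      (auto simp: less_imp_neq[symmetric])
  have eq: "?I {-a..a} = integral {-a..a} (\<lambda>t. of_real (g t / cos t * cos t) * cis (l * sin t))"
    using cospos by (intro integral_cong) (force simp: less_imp_neq[symmetric])
  have h'b: "\<bar>h' t\<bar> \<le> 2 / (cos t)\<^sup>2" for t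
  proof -
    have "\<bar>g' t * cos t + g t * sin t\<bar> \<le> 1 * 1 + 1 * 1"
      unfolding abs_mult using b abs_triangle_ineq
      by (intro order.trans[OF abs_triangle_ineq] add_mono) (auto simp: abs_mult intro!: mult_le_one)
    then show ?thesis unfolding h'_def by (simp add: divide_right_mono)
  qed
  \<comment> \<open>The integral of the bound 2 / cos t squared is explicit, since tan is an antiderivative
     up to the factor 2.\<close>
  have tan: "((\<lambda>t. 2 / (cos t)\<^sup>2) has_integral (2 * tan a - 2 * tan (-a))) {-a..a}"
  proof (rule fundamental_theorem_of_calculus)
    fix t assume "t \<in> {-a..a}"
    then show "((\<lambda>t. 2 * tan t) has_vector_derivative 2 / (cos t)\<^sup>2) (at t within {-a..a})"
      using cospos[of t] unfolding has_real_derivative_iff_has_vector_derivative[symmetric]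
      by (auto intro!: derivative_eq_intros simp: divide_inverse)
  qed (use a in auto)
  have int': "norm (integral {-a..a} (\<lambda>t. of_real (h' t) * cis (l * sin t))) \<le> integral {-a..a} (\<lambda>t. 2 / (cos t)\<^sup>2)"
    using tan h'b by (intro integral_norm_bound_integral integrable_continuous_interval continuous_intros ch)
       (auto simp: norm_mult dest!: cospos)
  have ca: "cos a \<ge> \<delta> / 2" using half_le_sin[of \<delta>] \<delta> pi_gt3 by (simp add: a_def cos_diff)
  have ca0: "cos a > 0" using ca \<delta> by linarith
  have "integral {-a..a} (\<lambda>t. 2 / (cos t)\<^sup>2) = 4 * tan a" using tan by (simp add: integral_unique)
  also have "\<dots> \<le> 4 / cos a" using ca0 by (simp add: tan_def divide_right_mono)
  finally have int'': "norm (integral {-a..a} (\<lambda>t. of_real (h' t) * cis (l * sin t))) \<le> 4 / cos a"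
    using int' by simp
  have bd: "norm (of_real (g t / cos t) * cis (l * sin t)) \<le> 1 / cos a" if "cos t = cos a" for t
    unfolding norm_mult using b(1)[of t] ca0 that by (simp add: abs_divide divide_right_mono del: of_real_divide)
  have parts: "\<i> * of_real l * ?I {-a..a} =
      of_real (g a / cos a) * cis (l * sin a) - of_real (g (-a) / cos (-a)) * cis (l * sin (-a))
      - integral {-a..a} (\<lambda>t. of_real (h' t) * cis (l * sin t))"
    unfolding eq using a by (intro osc_by_parts h ch) auto
  have "l * norm (?I {-a..a}) = norm (\<i> * of_real l * ?I {-a..a})" using l by (simp add: norm_mult)
  also have "\<dots> \<le> 1 / cos a + 1 / cos a + 4 / cos a"
    unfolding parts
    by (intro order.trans[OF norm_triangle_ineq4] add_mono int'' bd) auto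
  also have "\<dots> = 6 / cos a" by simp
  also have "\<dots> \<le> 6 / (\<delta> / 2)" using ca \<delta> by (intro divide_left_mono) auto
  also have "\<dots> = l * (12 * \<delta>)" using l\<delta> by (simp add: field_simps)
  finally have "norm (?I {-a..a}) \<le> 12 * \<delta>" using l by simp
  with split show ?thesis by (simp add: \<delta>_def)
qed

text \<open>
  The variable \<open>u = 1 - \<bar>sin t\<bar>\<close> is quadratic in the distance to \<open>\<plusminus>\<pi>/2\<close>, so \<open>cos\<^sup>m t dt\<close> becomes
  \<open>u\<^sup>(\<^sup>m\<^sup>-\<^sup>1\<^sup>)\<^sup>/\<^sup>2 du\<close> up to smooth factors, whence the exponent \<open>(m + 1)/2\<close>. The even and the odd
  integral are treated together because the recurrences connect each of them at \<open>m\<close> with the other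
  at \<open>m - 2\<close>. The base cases are \<open>m = 0\<close>, which is the stationary phase bound, and \<open>m = 1\<close>, where
  the even integral is elementary and the odd one reduces to it. For \<open>\<lambda> < 1\<close> the trivial bound \<open>\<pi>\<close>
  suffices, so the estimate holds for all \<open>\<lambda> > 0\<close>.
\<close>

lemma osc_decay:
  "\<exists>C\<ge>0. \<forall>l>0. norm (osc_even m l) \<le> C * l powr (- (real m + 1) / 2)
             \<and> norm (osc_odd m l) \<le> C * l powr (- (real m + 1) / 2)"
proof (induction m rule: less_induct)
  case (less m)
  let ?p = "\<lambda>l. l powr (- (real m + 1) / 2) :: real"
  have large: "\<exists>C\<ge>0. \<forall>l\<ge>1. norm (osc_even m l) \<le> C * ?p l \<and> norm (osc_odd m l) \<le> C * ?p l"
  proof -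
    consider "m = 0" | "m = 1" | k where "m = k + 2"
      by (metis One_nat_def add_2_eq_Suc' not0_implies_Suc)
    then show ?thesis
    proof cases
      case 1
      have "norm (osc_even m l) \<le> 14 * ?p l \<and> norm (osc_odd m l) \<le> 14 * ?p l" if "l \<ge> 1" for l
        using osc_stationary_bound[of "\<lambda>_. 1" "\<lambda>_. 0" l] osc_stationary_bound[of sin cos l] that
        by (auto simp: 1 osc_even_def osc_odd_def continuous_intros)
      then show ?thesis by (intro exI[of _ 14]) auto
    next
      case 2
      have "norm (osc_even m l) \<le> 5 * ?p l \<and> norm (osc_odd m l) \<le> 5 * ?p l" if l: "l \<ge> 1" for l
      proof -
        have e: "\<i> * of_real l * osc_even 1 l = cis l - cis (-l)"
          unfolding osc_even_def using osc_by_parts[of "-(pi/2)" "pi/2" "\<lambda>_. 1" "\<lambda>_. 0" l] by simp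
        have "\<i> * of_real l * osc_odd 1 l = cis l + cis (-l) - osc_even 1 l"
          unfolding osc_even_def osc_odd_def
          using osc_by_parts[of "-(pi/2)" "pi/2" sin cos l] by (simp add: mult_ac continuous_intros)
        then have o: "l * norm (osc_odd 1 l) = norm (cis l + cis (-l) - osc_even 1 l)"
          using l by (metis abs_of_nonneg mult_1 norm_ii norm_mult norm_of_real order.trans zero_le_one)
        have e': "l * norm (osc_even 1 l) \<le> 2"
          using norm_triangle_ineq4[of "cis l" "cis (-l)"] arg_cong[OF e, of norm] l by (simp add: norm_mult)
        have "1 * norm (osc_even 1 l) \<le> l * norm (osc_even 1 l)" using l by (intro mult_right_mono) auto
        then have "l * norm (osc_odd 1 l) \<le> 4"
          using norm_triangle_ineq4[of "cis l + cis (-l)" "osc_even 1 l"] norm_triangle_ineq[of "cis l" "cis (-l)"]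
            e' o by simp
        with e' l show ?thesis by (simp add: 2 powr_minus field_simps)
      qed
      then show ?thesis by (intro exI[of _ 5]) auto
    next
      case (3 k)
      obtain C where C: "C \<ge> 0" "\<And>l. l > 0 \<Longrightarrow> norm (osc_even k l) \<le> C * l powr (- (real k + 1) / 2)"
           "\<And>l. l > 0 \<Longrightarrow> norm (osc_odd k l) \<le> C * l powr (- (real k + 1) / 2)"
        using less.IH[of k] 3 by auto
      define C1 where "C1 = real (k+1) * C"
      define C2 where "C2 = real (k+1) * C + real (k+2) * C1"
      have "norm (osc_even m l) \<le> C1 * ?p l \<and> norm (osc_odd m l) \<le> C2 * ?p l" if l: "l \<ge> 1" for l
      proof -
        \<comment> \<open>Passing from k to m = k + 2 lowers the exponent by one, which the factor l absorbs.\<close>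
        have p: "l powr (- (real k + 1) / 2) = l * ?p l"
        proof -
          have "- (real k + 1) / 2 = 1 + - (real m + 1) / 2" using 3 by (simp add: field_simps)
          moreover have "l * ?p l = l powr (1 + - (real m + 1) / 2)"
            using l by (intro powr_mult_base) auto
          ultimately show ?thesis by (simp only:)
        qed
        have "l * norm (osc_even m l) = real (k+1) * norm (osc_odd k l)"
          using arg_cong[OF osc_even_recurrence[of l k], of norm] l 3 by (simp add: norm_mult del: of_nat_add of_nat_Suc)
        also have "\<dots> \<le> l * (C1 * ?p l)"
          using mult_left_mono[OF C(3)[of l], of "real (k+1)"] l p by (simp add: C1_def mult_ac)
        finally have 1: "norm (osc_even m l) \<le> C1 * ?p l" using l by simp
        have p1: "?p l \<le> l * ?p l" using l by (simp add: mult_le_cancel_right1)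
        have "l * norm (osc_odd m l) \<le> real (k+1) * norm (osc_even k l) + real (k+2) * norm (osc_even m l)"
          using arg_cong[OF osc_odd_recurrence[of l k], of norm] l 3 
            norm_triangle_ineq4[of "of_nat (k + 1) * osc_even k l" "of_nat (k + 2) * osc_even m l"]
          by (simp add: norm_mult del: of_nat_add of_nat_Suc)
        also have "\<dots> \<le> real (k+1) * (C * (l * ?p l)) + real (k+2) * (C1 * (l * ?p l))"
          using C(2)[of l] l p 1 p1 C(1)
          by (intro add_mono mult_left_mono order.trans[OF 1]) (auto simp: C1_def)
        also have "\<dots> = l * (C2 * ?p l)" by (simp add: C2_def algebra_simps)
        finally show ?thesis using 1 l by simp
      qed
      moreover have "C1 \<ge> 0" "C2 \<ge> 0" using C(1) by (auto simp: C1_def C2_def)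
      ultimately show ?thesis
        by (intro exI[of _ "max C1 C2"]) (fastforce intro: order.trans[OF _ mult_right_mono])
    qed
  qed
  then obtain C where C: "C \<ge> 0" "\<And>l. l \<ge> 1 \<Longrightarrow> norm (osc_even m l) \<le> C * ?p l"
    "\<And>l. l \<ge> 1 \<Longrightarrow> norm (osc_odd m l) \<le> C * ?p l" by blast
  have triv: "norm (osc_even m l) \<le> pi" "norm (osc_odd m l) \<le> pi" for l
  proof -
    have b: "\<bar>cos t ^ m\<bar> \<le> 1" for t :: real by (simp add: power_abs power_le_one)
    show "norm (osc_even m l) \<le> pi" unfolding osc_even_def
      using b by (intro order.trans[OF integral_bound[where B=1]] continuous_intros)
        (auto simp: norm_mult norm_power power_abs)
    have b': "\<bar>cos t\<bar> ^ m * \<bar>sin t\<bar> \<le> 1" for t :: real 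
      using b[of t] by (intro mult_le_one) (auto simp: power_abs)
    show "norm (osc_odd m l) \<le> pi" unfolding osc_odd_def
      using b' by (intro order.trans[OF integral_bound[where B=1]] continuous_intros)
        (auto simp: norm_mult norm_power power_abs)
  qed
  have "norm (osc_even m l) \<le> max C pi * ?p l \<and> norm (osc_odd m l) \<le> max C pi * ?p l" if l: "l > 0" for l
  proof (cases "l \<ge> 1")
    case True
    then show ?thesis using C(2,3)[of l]
      by (auto intro: order.trans[OF _ mult_right_mono])
  next
    case False
    then have "?p l \<ge> 1" using l powr_mono2'[of "- (real m + 1) / 2" l 1] by auto
    then have "pi * 1 \<le> max C pi * ?p l" using pi_gt_zero by (intro mult_mono) (auto simp: le_max_iff_disj)
    with triv[of l] show ?thesis by linarith
  qed
  moreover have "0 \<le> max C pi" using C(1) by simp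
  ultimately show ?case by blast
qed

section \<open>The Fourier transform of a ball\<close>

text \<open>
  Uniqueness of Haar measure in an elementary form: translation invariance and Fubini show that
  \<open>A \<mapsto> \<lambda>(T\<^sup>-\<^sup>1 A)\<close> is proportional to Lebesgue measure \<open>\<lambda>\<close>, and the factor is 1 because \<open>T\<close> preserves
  the unit ball.
\<close>

lemma lborel_orthogonal_invariant:
  fixes T :: "'a::euclidean_space \<Rightarrow> 'a"
  assumes T: "orthogonal_transformation T"
  shows "distr lborel borel T = lborel"
proof -
  have lin: "linear T" and inj: "inj T" and surj: "surj T"
    using T by (auto simp: orthogonal_transformation_linear orthogonal_transformation_inj orthogonal_transformation_surj)
  have cT: "continuous_on S T" for S
    using lin linear_continuous_on[of T S] linear_conv_bounded_linear by blast
  have Tm [measurable]: "T \<in> borel_measurable borel"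
    by (rule borel_measurable_continuous_onI) (rule cT)
  have shift: "(\<integral>\<^sup>+x. f (x + c) \<partial>lborel) = (\<integral>\<^sup>+x. f x \<partial>lborel)"
    if [measurable]: "f \<in> borel_measurable borel" for f :: "'a \<Rightarrow> ennreal" and c
  proof -
    have "(\<integral>\<^sup>+x. f x \<partial>lborel) = (\<integral>\<^sup>+x. f x \<partial>distr lborel borel ((+) c))"
      by (simp add: lborel_distr_plus)
    also have "\<dots> = (\<integral>\<^sup>+x. f (x + c) \<partial>lborel)" by (subst nn_integral_distr) (auto simp: add.commute)
    finally show ?thesis ..
  qed
  have refl: "(\<integral>\<^sup>+x. f (c - x) \<partial>lborel) = (\<integral>\<^sup>+x. f x \<partial>lborel)"
    if [measurable]: "f \<in> borel_measurable borel" for f :: "'a \<Rightarrow> ennreal" and c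
  proof -
    have "(\<integral>\<^sup>+x. f x \<partial>lborel) = (\<integral>\<^sup>+x. f (x + c) \<partial>lborel)" by (simp add: shift)
    also have "\<dots> = (\<integral>\<^sup>+x. f (x + c) \<partial>distr lborel borel uminus)"
      using lborel_affine[of "-1" "0 :: 'a"] by (simp add: density_1)
    also have "\<dots> = (\<integral>\<^sup>+x. f (c - x) \<partial>lborel)" by (subst nn_integral_distr) auto
    finally show ?thesis ..
  qed
  \<comment> \<open>Both sides are the double integral of the indicator of A at T x times that of B at y + T x,
     evaluated in two orders after a substitution in one of the variables.\<close>
  have key: "emeasure lborel (T -` A) * emeasure lborel B = emeasure lborel (T -` B) * emeasure lborel A"
    if [measurable]: "A \<in> sets borel" "B \<in> sets borel" for A B :: "'a set"
  proof -
    have em: "emeasure lborel (T -` A) = (\<integral>\<^sup>+x. indicator A (T x) \<partial>lborel)" 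
      if [measurable]: "A \<in> sets borel" for A
    proof -
      have "T -` A \<in> sets lborel" using measurable_sets[OF Tm that] by simp
      then have "emeasure lborel (T -` A) = (\<integral>\<^sup>+x. indicator (T -` A) x \<partial>lborel)"
        by (rule nn_integral_indicator[symmetric])
      then show ?thesis by (simp add: indicator_vimage)
    qed
    have em': "emeasure lborel A = (\<integral>\<^sup>+x. indicator A x \<partial>lborel)" 
      if [measurable]: "A \<in> sets borel" for A :: "'a set"
      using that by (intro nn_integral_indicator[symmetric]) auto
    have "emeasure lborel (T -` A) * emeasure lborel B
        = (\<integral>\<^sup>+x. indicator A (T x) * (\<integral>\<^sup>+y. indicator B y \<partial>lborel) \<partial>lborel)"
      unfolding em[OF that(1)] em'[OF that(2)] by (rule nn_integral_multc[symmetric]) measurable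
    also have "\<dots> = (\<integral>\<^sup>+x. (\<integral>\<^sup>+y. indicator A (T x) * indicator B (y + T x) \<partial>lborel) \<partial>lborel)"
      by (subst nn_integral_cmult, simp, subst shift) auto
    also have "\<dots> = (\<integral>\<^sup>+y. (\<integral>\<^sup>+x. indicator A (T x) * indicator B (y + T x) \<partial>lborel) \<partial>lborel)"
      by (rule lborel_pair.Fubini') measurable
    also have "\<dots> = (\<integral>\<^sup>+y. (\<integral>\<^sup>+x. indicator A (T x - y) * indicator B (T x) \<partial>lborel) \<partial>lborel)"
    proof (rule nn_integral_cong)
      fix y
      obtain z where z: "T z = - y" using surj by (metis surjD)
      have "T (x + z) = T x - y" for x using z linear_add[OF lin] by simp
      then show "(\<integral>\<^sup>+x. indicator A (T x) * indicator B (y + T x) \<partial>lborel)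
          = (\<integral>\<^sup>+x. indicator A (T x - y) * indicator B (T x) \<partial>lborel)"
        using shift[of "\<lambda>x. indicator A (T x) * indicator B (y + T x)" z] by simp
    qed
    also have "\<dots> = (\<integral>\<^sup>+x. (\<integral>\<^sup>+y. indicator A (T x - y) * indicator B (T x) \<partial>lborel) \<partial>lborel)"
      by (rule lborel_pair.Fubini') measurable
    also have "\<dots> = (\<integral>\<^sup>+x. emeasure lborel A * indicator B (T x) \<partial>lborel)"
      by (subst nn_integral_multc, simp, subst refl) auto
    also have "\<dots> = emeasure lborel (T -` B) * emeasure lborel A"
      by (simp add: em nn_integral_cmult mult.commute)
    finally show ?thesis .
  qed
  show ?thesis
  proof (rule measure_eqI)
    fix A assume "A \<in> sets (distr lborel borel T)"
    then have A: "A \<in> sets borel" by simp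
    let ?B = "cball 0 1 :: 'a set"
    have TB: "T -` ?B = ?B" using T by (auto simp: orthogonal_transformation_norm)
    have "emeasure lborel (T -` A) * emeasure lborel ?B = emeasure lborel A * emeasure lborel ?B"
      using key[OF A, of ?B] TB by (simp add: mult.commute)
    moreover have "emeasure lborel ?B \<noteq> 0" "emeasure lborel ?B \<noteq> \<infinity>"
      by (auto simp: emeasure_cball ennreal_eq_0_iff not_le)
    ultimately have "emeasure lborel (T -` A) = emeasure lborel A"
      by (metis ennreal_mult_divide_eq infinity_ennreal_def)
    then show "emeasure (distr lborel borel T) A = emeasure lborel A"
      using A by (simp add: emeasure_distr)
  qed simp
qed

text \<open>
  The \<open>(d - 1)\<close>-dimensional volume of the section of the ball of radius \<open>r\<close> at height \<open>y\<close>.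
\<close>

definition ball_slice :: "nat \<Rightarrow> real \<Rightarrow> real \<Rightarrow> real" where
  "ball_slice d r y = indicator {-r..r} y * (unit_ball_vol (real (d - 1)) * sqrt (r\<^sup>2 - y\<^sup>2) ^ (d - 1))"

lemma ball_slice_measurable [measurable]: "ball_slice d r \<in> borel_measurable borel"
  unfolding ball_slice_def by measurable

lemma ball_slice_nonneg: "0 \<le> ball_slice d r y"
proof (cases "y \<in> {-r..r}")
  case True
  then have "y\<^sup>2 \<le> r\<^sup>2" by (auto simp: abs_le_square_iff[symmetric])
  then show ?thesis by (simp add: ball_slice_def)
qed (simp add: ball_slice_def)

text \<open>
  The push-forward of Lebesgue measure on the ball under a coordinate function has the section
  volume as its density: this is Fubini with one coordinate singled out.
\<close>

lemma ball_marginal_Basis: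
  fixes b :: "'a::euclidean_space"
  assumes b: "b \<in> Basis" and r: "0 < r"
  shows "distr (density lborel (indicator (cball 0 r))) borel (\<lambda>x. x \<bullet> b) = density lborel (\<lambda>y. ennreal (ball_slice DIM('a) r y))"
proof (rule measure_eqI)
  fix A :: "real set" assume "A \<in> sets (distr (density lborel (indicator (cball 0 r))) borel (\<lambda>x. x \<bullet> b))"
  then have A [measurable]: "A \<in> sets borel" by simp
  define B' where "B' = Basis - {b}"
  have B': "finite B'" "b \<notin> B'" "insert b B' = Basis" "card B' = DIM('a) - 1"
    using b by (auto simp: B'_def)
  interpret product_sigma_finite "\<lambda>_. lborel :: real measure" by standard
  have "emeasure (distr (density lborel (indicator (cball 0 r))) borel (\<lambda>x. x \<bullet> b)) A
      = (\<integral>\<^sup>+x. indicator (cball 0 r) x * indicator A (x \<bullet> b) \<partial>(lborel :: 'a measure))"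
    by (subst emeasure_distr, simp, simp, subst emeasure_density)
       (auto simp: indicator_vimage[symmetric] vimage_def intro!: nn_integral_cong borel_measurable_indicator borel_closed split: split_indicator)
  also have "\<dots> = (\<integral>\<^sup>+f. indicator {f. sqrt (\<Sum>i\<in>Basis. (f i)\<^sup>2) \<le> r} f * indicator A (f b) \<partial>(Pi\<^sub>M Basis (\<lambda>_. lborel)))"
  proof -
    have "norm (\<Sum>i\<in>Basis. f i *\<^sub>R i :: 'a) = sqrt (\<Sum>i\<in>Basis. (f i)\<^sup>2)" for f
      using euclidean_dist_l2[of 0 "\<Sum>i\<in>Basis. f i *\<^sub>R i :: 'a"] by (simp add: L2_set_def)
    then show ?thesis
      using b by (subst lborel_eq, subst nn_integral_distr) (auto simp: indicator_def intro!: nn_integral_cong)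
  qed
  also have "\<dots> = (\<integral>\<^sup>+y. (\<integral>\<^sup>+f. indicator {f. sqrt (\<Sum>i\<in>Basis. (f i)\<^sup>2) \<le> r} (f(b := y)) * indicator A ((f(b := y)) b)
        \<partial>(Pi\<^sub>M B' (\<lambda>_. lborel))) \<partial>lborel)"
  proof -
    have "(\<lambda>f. indicator {f. sqrt (\<Sum>i\<in>Basis. (f i)\<^sup>2) \<le> r} f * indicator A (f b) :: ennreal)
        = (\<lambda>f. indicator {..r} (sqrt (\<Sum>i\<in>Basis. (f i)\<^sup>2)) * indicator A (f b))"
      by (auto simp: indicator_def fun_eq_iff)
    also have "\<dots> \<in> borel_measurable (Pi\<^sub>M Basis (\<lambda>_. lborel))"
      using b by measurable
    finally show ?thesis
      using B' product_nn_integral_insert_rev[of B' b] by simp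
  qed
  also have "\<dots> = (\<integral>\<^sup>+y. ennreal (ball_slice DIM('a) r y) * indicator A y \<partial>lborel)"
  proof (intro nn_integral_cong_AE)
    \<comment> \<open>At the two poles the section has radius zero, which the volume formula for balls excludes.\<close>
    have "AE y in lborel. y \<notin> {-r,r}"
      by (intro AE_not_in countable_imp_null_set_lborel) auto
    then show "AE y in lborel. (\<integral>\<^sup>+f. indicator {f. sqrt (\<Sum>i\<in>Basis. (f i)\<^sup>2) \<le> r} (f(b := y)) * indicator A ((f(b := y)) b)
        \<partial>(Pi\<^sub>M B' (\<lambda>_. lborel))) = ennreal (ball_slice DIM('a) r y) * indicator A y"
    proof eventually_elim
      case (elim y)
      let ?S = "{f. sqrt (\<Sum>i\<in>B'. (f i)\<^sup>2) \<le> sqrt (r\<^sup>2 - y\<^sup>2)}"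
      have "(\<Sum>i\<in>Basis. ((f(b := y)) i)\<^sup>2) = y\<^sup>2 + (\<Sum>i\<in>B'. (f i)\<^sup>2)" for f
        unfolding B'(3)[symmetric] using B'(1,2) by (simp add: sum.insert) (intro sum.cong, auto)
      then have ind: "indicator {f. sqrt (\<Sum>i\<in>Basis. (f i)\<^sup>2) \<le> r} (f(b := y)) 
          = (indicator {-r..r} y * indicator ?S f :: ennreal)" for f
      proof -
        have s: "0 \<le> (\<Sum>i\<in>B'. (f i)\<^sup>2)" by (simp add: sum_nonneg)
        have "sqrt (y\<^sup>2 + (\<Sum>i\<in>B'. (f i)\<^sup>2)) \<le> r \<longleftrightarrow> y\<^sup>2 + (\<Sum>i\<in>B'. (f i)\<^sup>2) \<le> r\<^sup>2"
          using r s by (simp add: real_sqrt_le_iff')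
        also have "\<dots> \<longleftrightarrow> y \<in> {-r..r} \<and> (\<Sum>i\<in>B'. (f i)\<^sup>2) \<le> r\<^sup>2 - y\<^sup>2"
        proof -
          have "y\<^sup>2 + (\<Sum>i\<in>B'. (f i)\<^sup>2) \<le> r\<^sup>2 \<Longrightarrow> y\<^sup>2 \<le> r\<^sup>2" using s by linarith
          then show ?thesis using r by (auto simp: abs_le_square_iff[symmetric])
        qed
        finally show ?thesis
          using \<open>(\<Sum>i\<in>Basis. ((f(b := y)) i)\<^sup>2) = y\<^sup>2 + (\<Sum>i\<in>B'. (f i)\<^sup>2)\<close> by (auto simp: indicator_def)
      qed
      have "(\<integral>\<^sup>+f. indicator {f. sqrt (\<Sum>i\<in>Basis. (f i)\<^sup>2) \<le> r} (f(b := y)) * indicator A ((f(b := y)) b)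
         \<partial>(Pi\<^sub>M B' (\<lambda>_. lborel))) = 
         (\<integral>\<^sup>+f. (indicator {-r..r} y * indicator A y) * indicator (?S \<inter> space (Pi\<^sub>M B' (\<lambda>_. lborel))) f \<partial>(Pi\<^sub>M B' (\<lambda>_. lborel)))"
        by (intro nn_integral_cong) (simp only: ind, auto simp: indicator_def)
      also have "\<dots> = indicator {-r..r} y * indicator A y * emeasure (Pi\<^sub>M B' (\<lambda>_. lborel)) (?S \<inter> space (Pi\<^sub>M B' (\<lambda>_. lborel)))"
        using B'(1) by (subst nn_integral_cmult_indicator) auto
      also have "\<dots> = ennreal (ball_slice DIM('a) r y) * indicator A y"
      proof (cases "y \<in> {-r<..<r}")
        case True
        then have "y\<^sup>2 < r\<^sup>2" by (subst real_sqrt_less_iff [symmetric]) auto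
        then show ?thesis using B' True
          by (subst emeasure_cball_aux) (auto simp: ball_slice_def indicator_def)
      qed (use elim in \<open>auto simp: ball_slice_def\<close>)
      finally show ?case .
    qed
  qed
  also have "\<dots> = emeasure (density lborel (\<lambda>y. ennreal (ball_slice DIM('a) r y))) A"
    by (subst emeasure_density) auto
  finally show "emeasure (distr (density lborel (indicator (cball 0 r))) borel (\<lambda>x. x \<bullet> b)) A = \<dots>" .
qed simp

text \<open>
  An arbitrary direction is reduced to a coordinate direction by a rotation.
\<close>

lemma ball_marginal:
  fixes u :: "real ^ 'n::finite"
  assumes u: "norm u = 1" and r: "0 < r"
  shows "distr (density lborel (indicator (cball 0 r))) borel (\<lambda>x. x \<bullet> u) = density lborel (\<lambda>y. ennreal (ball_slice CARD('n) r y))"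
proof -
  define b :: "real ^ 'n" where "b = axis undefined 1"
  have b: "b \<in> Basis" "norm b = 1" by (auto simp: b_def Basis_vec_def)
  obtain T where T: "orthogonal_transformation T" "T b = u"
    using orthogonal_transformation_exists[of b u] u b by auto
  have cT: "continuous_on S T" for S
    using T(1) linear_continuous_on[of T S] linear_conv_bounded_linear orthogonal_transformation_linear by blast
  have Tm [measurable]: "T \<in> borel_measurable borel"
    by (rule borel_measurable_continuous_onI) (rule cT)
  have dist: "distr (density lborel (indicator (cball 0 r))) borel T = density lborel (indicator (cball 0 r))"
  proof -
    have "indicator (cball 0 r) = (\<lambda>x. indicator (cball 0 r) (T x) :: ennreal)"
      using T(1) by (auto simp: indicator_def orthogonal_transformation_norm fun_eq_iff)
    then have "distr (density lborel (indicator (cball 0 r))) borel T 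
         = distr (density lborel (\<lambda>x. indicator (cball 0 r) (T x))) borel T" by simp
    also have "\<dots> = density (distr lborel borel T) (indicator (cball 0 r))"
      by (subst density_distr) (auto intro!: borel_measurable_indicator borel_closed)
    finally show ?thesis using lborel_orthogonal_invariant[OF T(1)] by simp
  qed
  have "distr (density lborel (indicator (cball 0 r))) borel (\<lambda>x. x \<bullet> u)
      = distr (distr (density lborel (indicator (cball 0 r))) borel T) borel (\<lambda>x. x \<bullet> u)"
    by (simp add: dist)
  also have "\<dots> = distr (density lborel (indicator (cball 0 r))) borel (\<lambda>x. T x \<bullet> T b)"
    by (subst distr_distr) (auto simp: comp_def T)
  also have "\<dots> = distr (density lborel (indicator (cball 0 r))) borel (\<lambda>x. x \<bullet> b)"
    using T(1) by (simp add: orthogonal_transformation_def)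
  finally show ?thesis using ball_marginal_Basis[OF b(1) r] by simp
qed

text \<open>
  The transform along \<open>u\<close> is the one-dimensional transform of the section volume; the substitution
  \<open>y = r sin t\<close> turns it into the oscillatory integral with exponent \<open>d\<close>, a Bessel function in
  disguise.
\<close>

lemma ball_fourier_transform:
  fixes u :: "real ^ 'n::finite"
  assumes u: "norm u = 1" and r: "0 < r"
  shows "(\<integral>x. indicator (cball 0 r) x *\<^sub>R cis (a * (x \<bullet> u)) \<partial>lborel)
    = of_real (unit_ball_vol (real (CARD('n) - 1)) * r ^ CARD('n)) * osc_even CARD('n) (a * r)"
proof -
  define d where "d = CARD('n)"
  define V where "V = unit_ball_vol (real (d - 1))"
  have d: "d > 0" by (simp add: d_def)
  have cm [measurable]: "(\<lambda>y. cis (a * y)) \<in> borel_measurable borel"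
    by (intro borel_measurable_continuous_onI continuous_intros)
  let ?f = "\<lambda>y. (V * sqrt (r\<^sup>2 - y\<^sup>2) ^ (d - 1)) *\<^sub>R cis (a * y)"
  have cf: "continuous_on S ?f" for S by (intro continuous_intros)
  have "(\<integral>x. indicator (cball 0 r) x *\<^sub>R cis (a * (x \<bullet> u)) \<partial>lborel)
      = (\<integral>x. cis (a * (x \<bullet> u)) \<partial>density lborel (\<lambda>x. ennreal (indicator (cball 0 r) x)))"
    by (subst integral_density) (auto intro!: borel_measurable_indicator borel_closed)
  also have "\<dots> = (\<integral>y. cis (a * y) \<partial>distr (density lborel (\<lambda>x. ennreal (indicator (cball 0 r) x))) borel (\<lambda>x. x \<bullet> u))"
    by (subst integral_distr) auto
  also have "\<dots> = (\<integral>y. cis (a * y) \<partial>density lborel (\<lambda>y. ennreal (ball_slice d r y)))"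
    using ball_marginal[OF u r] by (simp add: d_def ennreal_indicator)
  also have "\<dots> = (\<integral>y. ball_slice d r y *\<^sub>R cis (a * y) \<partial>lborel)"
    by (subst integral_density) (auto simp: ball_slice_nonneg)
  also have "\<dots> = (LINT y:{-r..r}|lborel. ?f y)"
    unfolding set_lebesgue_integral_def by (intro Bochner_Integration.integral_cong) (auto simp: ball_slice_def V_def)
  also have "\<dots> = integral {-r..r} ?f"
    by (intro set_borel_integral_eq_integral borel_integrable_atLeastAtMost') (rule cf)
  also have "\<dots> = integral {-(pi/2)..pi/2} (\<lambda>t. (r * cos t) *\<^sub>R ?f (r * sin t))"
  proof -
    have "((\<lambda>t. (r * cos t) *\<^sub>R ?f (r * sin t)) has_integral
        integral {r * sin (-(pi/2))..r * sin (pi/2)} ?f) {-(pi/2)..pi/2}"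
    proof (rule has_integral_substitution[where c = "-r" and d = r])
      have "\<bar>r * sin t\<bar> \<le> r" for t
        using r by (simp add: abs_mult mult_le_cancel_left1)
      then show "(\<lambda>t. r * sin t) ` {-(pi/2)..pi/2} \<subseteq> {-r..r}" by (auto simp: abs_le_iff minus_le_iff)
      show "((\<lambda>t. r * sin t) has_field_derivative r * cos t) (at t within {-(pi/2)..pi/2})" for t
        by (auto intro!: derivative_eq_intros)
      show "continuous_on {-r..r} ?f" by (rule cf)
    qed (use r in auto)
    then show ?thesis by (simp add: integral_unique)
  qed
  also have "\<dots> = integral {-(pi/2)..pi/2} (\<lambda>t. of_real (V * r ^ d) * (of_real (cos t ^ d) * cis (a * r * sin t)))"
  proof (rule integral_cong)
    fix t assume "t \<in> {-(pi/2)..pi/2}"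
    then have c: "cos t \<ge> 0" by (intro cos_ge_zero) auto
    have "r\<^sup>2 - (r * sin t)\<^sup>2 = (r * cos t)\<^sup>2"
      by (simp add: power_mult_distrib cos_squared_eq right_diff_distrib)
    then have "sqrt (r\<^sup>2 - (r * sin t)\<^sup>2) = r * cos t" using c r by simp
    then show "(r * cos t) *\<^sub>R ?f (r * sin t) = of_real (V * r ^ d) * (of_real (cos t ^ d) * cis (a * r * sin t))"
      using d by (cases d) (simp_all add: scaleR_conv_of_real power_mult_distrib mult_ac)
  qed
  also have "\<dots> = of_real (V * r ^ d) * osc_even d (a * r)"
    unfolding osc_even_def by (rule integral_mult_right)
  finally show ?thesis by (simp add: V_def d_def)
qed

text \<open>
  The exponent comes from the curvature of the sphere; for a cube the decay along a coordinate axis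
  would only be \<open>O(\<bar>\<xi>\<bar>\<^sup>-\<^sup>1)\<close>.
\<close>

lemma ball_fourier_decay:
  assumes r: "0 < r"
  shows "\<exists>C\<ge>0. \<forall>\<xi>::real ^ 'n::finite. \<xi> \<noteq> 0 \<longrightarrow>
     norm (\<integral>x. indicator (cball 0 r) x *\<^sub>R cis (2 * pi * (\<xi> \<bullet> x)) \<partial>lborel) \<le> C * norm \<xi> powr (- (real CARD('n) + 1) / 2)"
proof -
  obtain C where C: "C \<ge> 0" "\<And>l. l > 0 \<Longrightarrow> norm (osc_even CARD('n) l) \<le> C * l powr (- (real CARD('n) + 1) / 2)"
    using osc_decay[of "CARD('n)"] by blast
  define W where "W = unit_ball_vol (real (CARD('n) - 1)) * r ^ CARD('n)"
  have W: "W \<ge> 0" using r by (simp add: W_def)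
  let ?e = "- (real CARD('n) + 1) / 2"
  have "norm (\<integral>x. indicator (cball 0 r) x *\<^sub>R cis (2 * pi * (\<xi> \<bullet> x)) \<partial>lborel) \<le> W * C * (2 * pi * r) powr ?e * norm \<xi> powr ?e"
    if "\<xi> \<noteq> 0" for \<xi> :: "real ^ 'n"
  proof -
    define u where "u = \<xi> /\<^sub>R norm \<xi>"
    have u: "norm u = 1" "\<xi> = norm \<xi> *\<^sub>R u" using that by (auto simp: u_def)
    have eq: "2 * pi * (\<xi> \<bullet> x) = (2 * pi * norm \<xi>) * (x \<bullet> u)" for x
      by (subst u(2)) (simp add: inner_commute)
    have "norm (\<integral>x. indicator (cball 0 r) x *\<^sub>R cis (2 * pi * (\<xi> \<bullet> x)) \<partial>lborel) = W * norm (osc_even CARD('n) (2 * pi * norm \<xi> * r))"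
      unfolding eq ball_fourier_transform[OF u(1) r] norm_mult norm_of_real W_def[symmetric] using W by simp
    also have "\<dots> \<le> W * (C * (2 * pi * norm \<xi> * r) powr ?e)"
      using that r by (intro mult_left_mono C W) auto
    also have "(2 * pi * norm \<xi> * r) powr ?e = (2 * pi * r) powr ?e * norm \<xi> powr ?e"
      using r by (subst powr_mult[symmetric]) (auto simp: mult_ac)
    finally show ?thesis by (simp add: mult_ac)
  qed
  then show ?thesis using W C(1) by (intro exI[of _ "W * C * (2 * pi * r) powr ?e"]) auto
qed

section \<open>Characters and Lebesgue measure on the torus\<close>

definition of_int_vec :: "int ^ 'n \<Rightarrow> real ^ 'n" where
  "of_int_vec k = (\<chi> i. of_int (k $ i))"

definition fchar :: "int ^ 'n \<Rightarrow> real ^ 'n \<Rightarrow> complex" where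
  "fchar k x = cis (2 * pi * (of_int_vec k \<bullet> x))"

lemma of_int_vec_simps [simp]:
  "of_int_vec k $ i = of_int (k $ i)"
  "of_int_vec (k + l) = of_int_vec k + of_int_vec l"
  "of_int_vec (k - l) = of_int_vec k - of_int_vec l"
  "of_int_vec 0 = 0"
  "of_int_vec k = 0 \<longleftrightarrow> k = 0"
  by (auto simp: of_int_vec_def vec_eq_iff)

lemma int_lattice_closed:
  "0 \<in> int_lattice"
  "a \<in> int_lattice \<Longrightarrow> b \<in> int_lattice \<Longrightarrow> a + b \<in> int_lattice"
  "a \<in> int_lattice \<Longrightarrow> b \<in> int_lattice \<Longrightarrow> a - b \<in> int_lattice"
  "a \<in> int_lattice \<Longrightarrow> - a \<in> int_lattice"
  by (auto simp: int_lattice_def)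

lemma fchar_add_right: "fchar k (x + y) = fchar k x * fchar k y"
  by (simp add: fchar_def cis_mult inner_add_right distrib_left)

lemma fchar_diff_right: "fchar k (x - y) = fchar k x * cnj (fchar k y)"
  by (simp add: fchar_def cis_mult cis_cnj inner_diff_right right_diff_distrib)

lemma fchar_add_left: "fchar (k + l) x = fchar k x * fchar l x"
  by (simp add: fchar_def cis_mult inner_add_left distrib_left)

lemma fchar_diff_left: "fchar (k - l) x = fchar k x * cnj (fchar l x)"
  by (simp add: fchar_def cis_mult cis_cnj inner_diff_left right_diff_distrib)

lemma fchar_0 [simp]: "fchar 0 x = 1" "fchar k 0 = 1"
  by (simp_all add: fchar_def)

lemma norm_fchar [simp]: "norm (fchar k x) = 1"
  by (simp add: fchar_def)

lemma fchar_int_lattice: "m \<in> int_lattice \<Longrightarrow> fchar k m = 1"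
proof -
  assume m: "m \<in> int_lattice"
  have "of_int_vec k \<bullet> m \<in> \<int>"
    unfolding inner_vec_def using m by (auto simp: int_lattice_def intro!: Ints_sum)
  then obtain j where "of_int_vec k \<bullet> m = of_int j" by (auto elim: Ints_cases)
  then show "fchar k m = 1" by (simp add: fchar_def)
qed

lemma continuous_on_fchar: "continuous_on S (fchar k)"
  unfolding fchar_def by (intro continuous_intros)

lemma borel_measurable_fchar [measurable]: "fchar k \<in> borel_measurable borel"
  by (intro borel_measurable_continuous_onI continuous_on_fchar)

lemma borel_measurable_cnj_fchar [measurable]: "(\<lambda>x. cnj (fchar k x)) \<in> borel_measurable borel"
  by (intro borel_measurable_continuous_onI continuous_intros continuous_on_fchar)

lemma countable_int_lattice: "countable (int_lattice :: (real ^ 'n::finite) set)"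
  unfolding int_lattice_def by (rule countable_vector) (simp add: Ints_def)

lemma torus_rep_periodic:
  assumes "m \<in> int_lattice" shows "torus_rep (x + m) = torus_rep x"
proof (rule torus_rep_eqI[OF torus_rep_in_torus])
  have "(torus_rep x - x) - m \<in> int_lattice"
    by (intro int_lattice_closed torus_rep_diff_int_lattice assms)
  then show "torus_rep x - (x + m) \<in> int_lattice" by (simp add: algebra_simps)
qed

lemma torus_rep_id: "x \<in> torus \<Longrightarrow> torus_rep x = x"
  by (rule torus_rep_eqI) (auto simp: int_lattice_closed)

lemma torus_add_lattice_unique:
  assumes "x \<in> torus" "x + m \<in> torus" "m \<in> int_lattice" shows "m = 0"
  using torus_rep_periodic[OF assms(3), of x] torus_rep_id[OF assms(1)] torus_rep_id[OF assms(2)] by simp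

lemma torus_borel_set [measurable]: "torus \<in> sets (borel :: (real ^ 'n::finite) measure)"
proof -
  have *: "(\<lambda>x :: real ^ 'n. x $ i) \<in> borel_measurable borel" for i
    by (intro borel_measurable_continuous_onI continuous_intros)
  show ?thesis unfolding torus_def using * by measurable
qed

lemma space_torus_lebesgue [simp]: "space torus_lebesgue = torus"
  by (simp add: torus_lebesgue_def space_restrict_space)

lemma space_torus_borel [simp]: "space torus_borel = torus"
  by (simp add: torus_borel_def space_restrict_space)

lemma sets_torus_lebesgue: "sets torus_lebesgue = sets torus_borel"
  by (simp add: torus_lebesgue_def torus_borel_def sets_restrict_space)

lemma emeasure_torus: "emeasure lborel (torus :: (real ^ 'n::finite) set) = 1"
proof (rule antisym)
  define c0 :: "real ^ 'n" where "c0 = (\<chi> i. 1 / 2)"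
  have in1: "c0 \<bullet> b = 1 / 2" if "b \<in> Basis" for b
    using that by (auto simp: c0_def Basis_vec_def inner_axis)
  have e: "emeasure lborel (cbox (- c0) c0) = 1" "emeasure lborel (box (- c0) c0) = 1"
  proof -
    have p: "(\<Prod>b\<in>Basis. (c0 - - c0) \<bullet> b) = 1"
    proof (intro prod.neutral ballI)
      fix b :: "real ^ 'n" assume "b \<in> Basis"
      then show "(c0 - - c0) \<bullet> b = 1" unfolding inner_diff_left inner_minus_left using in1[of b] by simp
    qed
    show "emeasure lborel (cbox (- c0) c0) = 1" "emeasure lborel (box (- c0) c0) = 1"
      by (subst emeasure_lborel_cbox emeasure_lborel_box, simp add: in1, simp only: p, simp)+
  qed
  have sub: "box (- c0) c0 \<subseteq> torus" "torus \<subseteq> cbox (- c0) c0"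
    by (auto simp: torus_def mem_box_cart c0_def subset_eq less_eq_real_def)
  show "emeasure lborel (torus :: (real ^ 'n) set) \<le> 1" "(1 :: ennreal) \<le> emeasure lborel (torus :: (real ^ 'n) set)"
    using emeasure_mono[OF sub(2), of lborel] emeasure_mono[OF sub(1), of lborel] e by simp_all
qed

lemma prob_space_torus_lebesgue: "prob_space (torus_lebesgue :: (real ^ 'n::finite) measure)"
  by (rule prob_spaceI) (simp add: torus_lebesgue_def emeasure_restrict_space emeasure_torus)

lemma measurable_torus_lebesgue [measurable (raw)]:
  "f \<in> borel \<rightarrow>\<^sub>M N \<Longrightarrow> f \<in> torus_lebesgue \<rightarrow>\<^sub>M N"
  unfolding torus_lebesgue_def by (intro measurable_restrict_space1) simp

text \<open>
  The preimage of \<open>A\<close> under the translation consists of pieces indexed by the lattice vector \<open>m\<close> that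
  brings the translated point back into the cube. Moving each piece by \<open>s + m\<close> reassembles \<open>A\<close>, since
  the translates of the cube by the lattice tile the space.
\<close>

lemma torus_lebesgue_translate:
  fixes s :: "real ^ 'n::finite"
  shows "distr torus_lebesgue torus_borel (\<lambda>x. torus_rep (x + s)) = torus_lebesgue"
proof (rule measure_eqI)
  fix A assume "A \<in> sets (distr torus_lebesgue torus_borel (\<lambda>x. torus_rep (x + s)))"
  then have A: "A \<in> sets borel" "A \<subseteq> torus" and A': "A \<in> sets torus_borel"
    by (auto simp: torus_borel_def sets_restrict_space_iff)
  note [measurable] = A(1)
  have rm: "(\<lambda>x. torus_rep (x + s)) \<in> torus_lebesgue \<rightarrow>\<^sub>M torus_borel"
    by (intro measurable_torus_lebesgue measurable_compose[OF _ torus_rep_measurable]) simp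
  define X where "X = (\<lambda>m. {x \<in> torus. x + (s + m) \<in> A})"
  define Y where "Y = (\<lambda>m. {x \<in> A. x - (s + m) \<in> torus})"
  have meas: "X m \<in> sets borel" "Y m \<in> sets borel" for m
    unfolding X_def Y_def by measurable
  have "emeasure (distr torus_lebesgue torus_borel (\<lambda>x. torus_rep (x + s))) A
      = emeasure lborel {x \<in> torus. torus_rep (x + s) \<in> A}"
    using rm A' by (subst emeasure_distr) 
      (auto simp: torus_lebesgue_def space_restrict_space emeasure_restrict_space vimage_def Int_def conj_commute)
  also have "{x \<in> torus. torus_rep (x + s) \<in> A} = (\<Union>m\<in>int_lattice. X m)"
  proof (intro set_eqI iffI)
    fix x assume x: "x \<in> {x \<in> torus. torus_rep (x + s) \<in> A}"
    then have "x \<in> X (torus_rep (x + s) - (x + s))" by (simp add: X_def)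
    then show "x \<in> (\<Union>m\<in>int_lattice. X m)" using torus_rep_diff_int_lattice by blast
  next
    fix x assume "x \<in> (\<Union>m\<in>int_lattice. X m)"
    then obtain m where m: "m \<in> int_lattice" "x \<in> torus" "x + s + m \<in> A" by (auto simp: X_def add.assoc)
    then have "torus_rep (x + s) = x + s + m" using A(2) by (intro torus_rep_eqI) auto
    with m show "x \<in> {x \<in> torus. torus_rep (x + s) \<in> A}" by simp
  qed
  also have "emeasure lborel \<dots> = (\<integral>\<^sup>+m. emeasure lborel (X m) \<partial>count_space int_lattice)"
  proof (rule emeasure_UN_countable)
    show "disjoint_family_on X int_lattice"
      unfolding disjoint_family_on_def
    proof (intro ballI impI, rule ccontr)
      fix m k :: "real ^ 'n" assume mk: "m \<in> int_lattice" "k \<in> int_lattice" "m \<noteq> k" "X m \<inter> X k \<noteq> {}"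
      then obtain x where "x + (s + m) \<in> torus" "x + (s + k) \<in> torus" using A(2) by (auto simp: X_def)
      then have "k - m = 0" using mk by (intro torus_add_lattice_unique[of "x + (s + m)"]) 
          (auto simp: int_lattice_closed algebra_simps)
      with mk show False by simp
    qed
  qed (use meas countable_int_lattice in auto)
  also have "\<dots> = (\<integral>\<^sup>+m. emeasure lborel (Y m) \<partial>count_space int_lattice)"
  proof (rule nn_integral_cong)
    fix m
    have "emeasure lborel (Y m) = emeasure (distr lborel borel ((+) (s + m))) (Y m)"
      by (simp add: lborel_distr_plus)
    also have "\<dots> = emeasure lborel (X m)"
      using meas by (subst emeasure_distr) (auto simp: X_def Y_def vimage_def add.commute intro!: arg_cong[where f="emeasure lborel"])
    finally show "emeasure lborel (X m) = emeasure lborel (Y m)" ..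
  qed
  also have "\<dots> = emeasure lborel (\<Union>m\<in>int_lattice. Y m)"
  proof (rule emeasure_UN_countable[symmetric])
    show "disjoint_family_on Y int_lattice"
      unfolding disjoint_family_on_def
    proof (intro ballI impI, rule ccontr)
      fix m k :: "real ^ 'n" assume mk: "m \<in> int_lattice" "k \<in> int_lattice" "m \<noteq> k" "Y m \<inter> Y k \<noteq> {}"
      then obtain x where "x - (s + m) \<in> torus" "x - (s + k) \<in> torus" by (auto simp: Y_def)
      then have "m - k = 0" using mk by (intro torus_add_lattice_unique[of "x - (s + m)"]) 
          (auto simp: int_lattice_closed algebra_simps)
      with mk show False by simp
    qed
  qed (use meas countable_int_lattice in auto)
  also have "(\<Union>m\<in>int_lattice. Y m) = A"
  proof (intro set_eqI iffI)
    fix x assume x: "x \<in> A"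
    have "- (torus_rep (x - s) - (x - s)) \<in> int_lattice"
      by (intro int_lattice_closed torus_rep_diff_int_lattice)
    moreover have "x \<in> Y (- (torus_rep (x - s) - (x - s)))" 
      using x torus_rep_in_torus by (simp add: Y_def algebra_simps)
    ultimately show "x \<in> (\<Union>m\<in>int_lattice. Y m)" by blast
  qed (auto simp: Y_def)
  also have "emeasure lborel A = emeasure torus_lebesgue A"
    using A by (simp add: torus_lebesgue_def emeasure_restrict_space)
  finally show "emeasure (distr torus_lebesgue torus_borel (\<lambda>x. torus_rep (x + s))) A = emeasure torus_lebesgue A" .
qed (simp add: sets_torus_lebesgue)

lemma torus_integral_translate:
  fixes h :: "real ^ 'n::finite \<Rightarrow> 'b::{banach, second_countable_topology}"
  assumes [measurable]: "h \<in> borel_measurable borel"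
    and per: "\<And>x m. m \<in> int_lattice \<Longrightarrow> h (x + m) = h x"
  shows "(\<integral>x. h (x + s) \<partial>torus_lebesgue) = (\<integral>x. h x \<partial>torus_lebesgue)"
proof -
  have rep: "h (torus_rep x) = h x" for x
    using per[OF torus_rep_diff_int_lattice[of x], of x] by simp
  have "(\<integral>x. h x \<partial>torus_lebesgue) = (\<integral>x. h x \<partial>distr torus_lebesgue torus_borel (\<lambda>x. torus_rep (x + s)))"
    by (simp add: torus_lebesgue_translate)
  also have "\<dots> = (\<integral>x. h (torus_rep (x + s)) \<partial>torus_lebesgue)"
    by (intro integral_distr measurable_torus_lebesgue measurable_compose[OF _ torus_rep_measurable])
       (auto simp: torus_borel_def intro!: measurable_restrict_space1)
  finally show ?thesis by (simp add: rep)
qed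

text \<open>
  Translation invariance alone produces all the vanishing integrals: the orthogonality of the
  characters, and below the vanishing of the Fourier coefficients of a function with a finer
  period.
\<close>

lemma torus_integral_char_vanish:
  fixes h :: "real ^ 'n::finite \<Rightarrow> complex"
  assumes h: "h \<in> borel_measurable borel"
    and per: "\<And>x m. m \<in> int_lattice \<Longrightarrow> h (x + m) = h x"
    and s: "\<And>x. h (x + s) = c * h x" "c \<noteq> 1"
  shows "(\<integral>x. h x \<partial>torus_lebesgue) = 0"
  using torus_integral_translate[OF h per, of s] s by simp

lemma fchar_periodic: "m \<in> int_lattice \<Longrightarrow> fchar k (x + m) = fchar k x"
  by (simp add: fchar_add_right fchar_int_lattice)

lemma fchar_orthogonal:
  fixes k :: "int ^ 'n::finite"
  shows "(\<integral>x. fchar k x \<partial>torus_lebesgue) = (if k = 0 then 1 else 0)"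
proof (cases "k = 0")
  case True
  interpret prob_space "torus_lebesgue :: (real ^ 'n) measure" by (rule prob_space_torus_lebesgue)
  show ?thesis using True prob_space by simp
next
  case False
  then obtain i where i: "k $ i \<noteq> 0" by (auto simp: vec_eq_iff)
  have "fchar k (axis i (1 / (2 * of_int (k $ i)))) = -1"
    using i by (simp add: fchar_def inner_axis)
  then have "(\<integral>x. fchar k x \<partial>torus_lebesgue) = 0"
    by (intro torus_integral_char_vanish[where s = "axis i (1 / (2 * of_int (k $ i)))" and c = "-1"])
       (auto simp: fchar_int_lattice fchar_add_right)
  then show ?thesis using False by simp
qed

section \<open>Fejer summation and the Parseval inequality\<close>

lemma card_int_vec_box:
  fixes S :: "'n::finite \<Rightarrow> int set"
  shows "card {k :: int ^ 'n. \<forall>i. k $ i \<in> S i} = (\<Prod>i\<in>UNIV. card (S i))"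
proof -
  have "{k :: int ^ 'n. \<forall>i. k $ i \<in> S i} = vec_lambda ` (Pi\<^sub>E UNIV S)"
  proof (intro set_eqI iffI)
    fix k :: "int ^ 'n" assume "k \<in> {k. \<forall>i. k $ i \<in> S i}"
    then have "vec_lambda (vec_nth k) \<in> vec_lambda ` (Pi\<^sub>E UNIV S)" by (intro imageI) auto
    then show "k \<in> vec_lambda ` (Pi\<^sub>E UNIV S)" by simp
  qed auto
  also have "card \<dots> = card (Pi\<^sub>E UNIV S)"
    by (intro card_image inj_onI) (simp add: vec_lambda_inject)
  also have "\<dots> = (\<Prod>i\<in>UNIV. card (S i))" by (simp add: card_PiE)
  finally show ?thesis .
qed

lemma finite_int_vec_box:
  fixes S :: "'n::finite \<Rightarrow> int set"
  assumes "\<And>i. finite (S i)"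
  shows "finite {k :: int ^ 'n. \<forall>i. k $ i \<in> S i}"
proof -
  have "{k :: int ^ 'n. \<forall>i. k $ i \<in> S i} \<subseteq> vec_lambda ` (Pi\<^sub>E UNIV S)"
  proof
    fix k :: "int ^ 'n" assume "k \<in> {k. \<forall>i. k $ i \<in> S i}"
    then have "vec_lambda (vec_nth k) \<in> vec_lambda ` (Pi\<^sub>E UNIV S)" by (intro imageI) auto
    then show "k \<in> vec_lambda ` (Pi\<^sub>E UNIV S)" by simp
  qed
  then show ?thesis by (rule finite_subset) (auto intro!: finite_imageI finite_PiE assms)
qed

definition freq_box :: "nat \<Rightarrow> (int ^ 'n) set" where
  "freq_box n = {k. \<forall>i. k $ i \<in> {0..<int n}}"

lemma finite_freq_box [simp]: "finite (freq_box n :: (int ^ 'n::finite) set)"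
  unfolding freq_box_def by (rule finite_int_vec_box) simp

lemma card_freq_box: "card (freq_box n :: (int ^ 'n::finite) set) = n ^ CARD('n)"
  unfolding freq_box_def by (subst card_int_vec_box) simp

lemma card_freq_box_face:
  "card {k \<in> (freq_box n :: (int ^ 'n::finite) set). k $ i = a} \<le> n ^ (CARD('n) - 1)"
proof -
  have "card {k \<in> (freq_box n :: (int ^ 'n) set). k $ i = a}
      \<le> card {k :: int ^ 'n. \<forall>j. k $ j \<in> (if j = i then {a} else {0..<int n})}"
    by (intro card_mono finite_int_vec_box) (auto simp: freq_box_def)
  also have "\<dots> = (\<Prod>j\<in>UNIV. if j = i then 1 else n)"
    by (subst card_int_vec_box) (intro prod.cong, auto)
  also have "\<dots> = n ^ (CARD('n) - 1)"
    by (subst prod.remove[of _ i]) (auto simp: prod.If_cases card_Diff_singleton)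
  finally show ?thesis .
qed

text \<open>
  The Fejer kernel, as the normalized square of the sum of all characters from a box. In this form
  positivity is visible, and its Fourier coefficients count pairs of frequencies in the box with a
  given difference.
\<close>

definition fejer :: "nat \<Rightarrow> real ^ 'n::finite \<Rightarrow> real" where
  "fejer n x = (norm (\<Sum>k\<in>freq_box n. fchar k x))\<^sup>2 / real (n ^ CARD('n))"

lemma fejer_nonneg: "0 \<le> fejer n x"
  by (simp add: fejer_def)

lemma fejer_le: "fejer n x \<le> real (n ^ CARD('n))" for x :: "real ^ 'n::finite"
proof -
  have "norm (\<Sum>k\<in>freq_box n. fchar k x) \<le> real (n ^ CARD('n))"
    using norm_sum[of "\<lambda>k. fchar k x" "freq_box n"] by (simp add: card_freq_box)
  then have "(norm (\<Sum>k\<in>freq_box n. fchar k x))\<^sup>2 \<le> (real (n ^ CARD('n)))\<^sup>2" by (rule power_mono) simp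
  then show ?thesis unfolding fejer_def
    by (cases "n = 0") (simp_all add: divide_le_eq power2_eq_square)
qed

lemma continuous_on_fejer: "continuous_on S (fejer n)"
  unfolding fejer_def divide_inverse by (intro continuous_intros continuous_on_fchar)

lemma borel_measurable_fejer [measurable]: "fejer n \<in> borel_measurable borel"
  by (intro borel_measurable_continuous_onI continuous_on_fejer)

lemma fejer_periodic: "m \<in> int_lattice \<Longrightarrow> fejer n (x + m) = fejer n x"
  by (simp add: fejer_def fchar_periodic)

lemma integrable_torus_bounded:
  fixes f :: "real ^ 'n::finite \<Rightarrow> 'b::{banach, second_countable_topology}"
  assumes "f \<in> borel_measurable borel" "\<And>x. norm (f x) \<le> B"
  shows "integrable torus_lebesgue f"
proof -
  interpret prob_space "torus_lebesgue :: (real ^ 'n) measure" by (rule prob_space_torus_lebesgue)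
  show ?thesis by (rule integrable_const_bound[of _ B]) (use assms in \<open>auto intro: measurable_torus_lebesgue\<close>)
qed

lemma trig_sum_norm_sq:
  "complex_of_real ((norm (\<Sum>k\<in>S. a k * fchar k x))\<^sup>2)
     = (\<Sum>k\<in>S. \<Sum>l\<in>S. a k * cnj (a l) * fchar (k - l) x)"
  unfolding complex_norm_square cnj_sum sum_product
  by (intro sum.cong refl) (simp add: fchar_diff_left mult_ac)

lemma trig_sum_parseval:
  fixes a :: "int ^ 'n::finite \<Rightarrow> complex"
  assumes "finite S"
  shows "(\<integral>x. (norm (\<Sum>k\<in>S. a k * fchar k x))\<^sup>2 \<partial>torus_lebesgue) = (\<Sum>k\<in>S. (norm (a k))\<^sup>2)"
proof -
  have i: "integrable torus_lebesgue (\<lambda>x. z * fchar k x)" for z and k :: "int ^ 'n"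
    by (rule integrable_torus_bounded[of _ "norm z"]) (auto simp: norm_mult)
  have "complex_of_real (\<integral>x. (norm (\<Sum>k\<in>S. a k * fchar k x))\<^sup>2 \<partial>torus_lebesgue)
      = (\<integral>x. (\<Sum>k\<in>S. \<Sum>l\<in>S. a k * cnj (a l) * fchar (k - l) x) \<partial>torus_lebesgue)"
    by (simp only: integral_complex_of_real[symmetric] trig_sum_norm_sq)
  also have "\<dots> = (\<Sum>k\<in>S. \<Sum>l\<in>S. a k * cnj (a l) * (\<integral>x. fchar (k - l) x \<partial>torus_lebesgue))"
    by (simp add: Bochner_Integration.integral_sum Bochner_Integration.integrable_sum i)
  also have "\<dots> = (\<Sum>k\<in>S. \<Sum>l\<in>S. if k = l then a k * cnj (a l) else 0)"
    by (intro sum.cong refl) (simp add: fchar_orthogonal)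
  also have "\<dots> = complex_of_real (\<Sum>k\<in>S. (norm (a k))\<^sup>2)"
    using assms by (simp add: complex_norm_square[symmetric])
  finally show ?thesis by (simp only: of_real_eq_iff)
qed

lemma fejer_integral:
  assumes "n > 0"
  shows "(\<integral>x. fejer n x \<partial>(torus_lebesgue :: (real ^ 'n::finite) measure)) = 1"
  using trig_sum_parseval[of "freq_box n :: (int ^ 'n) set" "\<lambda>_. 1"] assms
  by (simp add: fejer_def card_freq_box)

text \<open>
  A trigonometric polynomial that is comparable to the squared distance from the lattice. It
  measures the concentration of the Fejer kernel without any integral over a part of the torus.
\<close>

definition torus_gauge :: "real ^ 'n::finite \<Rightarrow> real" where
  "torus_gauge x = (\<Sum>i\<in>UNIV. (norm (1 - fchar (axis i 1) x))\<^sup>2)"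

lemma torus_gauge_periodic: "m \<in> int_lattice \<Longrightarrow> torus_gauge (x + m) = torus_gauge x"
  by (simp add: torus_gauge_def fchar_periodic)

lemma borel_measurable_torus_gauge [measurable]: "torus_gauge \<in> borel_measurable borel"
  unfolding torus_gauge_def by measurable

lemma torus_gauge_nonneg: "0 \<le> torus_gauge x"
  by (simp add: torus_gauge_def sum_nonneg)

lemma torus_gauge_le: "torus_gauge x \<le> 4 * real CARD('n)" for x :: "real ^ 'n::finite"
proof -
  have "(norm (1 - fchar (axis i 1) x))\<^sup>2 \<le> 4" for i
    using norm_triangle_ineq4[of 1 "fchar (axis i 1) x"] power_mono[of "norm (1 - fchar (axis i 1) x)" 2 2] by simp
  then have "torus_gauge x \<le> (\<Sum>i\<in>(UNIV :: 'n set). 4)" unfolding torus_gauge_def by (intro sum_mono)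
  then show ?thesis by simp
qed

lemma norm_torus_rep_le_gauge: "(norm (torus_rep x))\<^sup>2 \<le> torus_gauge x"
proof -
  define u where "u = torus_rep x"
  have u: "u \<in> torus" by (simp add: u_def torus_rep_in_torus)
  have "torus_gauge x = torus_gauge u"
    using torus_gauge_periodic[OF torus_rep_diff_int_lattice[of x], of x] by (simp add: u_def)
  moreover have "(u $ i)\<^sup>2 \<le> (norm (1 - fchar (axis i 1) u))\<^sup>2" for i
  proof -
    let ?t = "\<bar>u $ i\<bar>"
    have t: "?t \<le> 1 / 2" using u by (auto simp: torus_def abs_le_iff dest!: spec[of _ i])
    have ax: "of_int_vec (axis i 1) = axis i (1::real)" by (simp add: vec_eq_iff axis_def)
    have "fchar (axis i 1) u = cis (2 * (pi * u $ i))"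
      by (simp add: fchar_def ax inner_axis' mult.assoc)
    moreover have "(norm (1 - cis (2 * v)))\<^sup>2 = 4 * (sin v)\<^sup>2" for v
    proof -
      have "(norm (1 - cis (2 * v)))\<^sup>2 = (1 - cos (2 * v))\<^sup>2 + (sin (2 * v))\<^sup>2"
        by (simp add: cmod_power2)
      also have "\<dots> = 2 - 2 * cos (2 * v)"
        using sin_cos_squared_add[of "2 * v"] by (simp add: power2_diff)
      finally show ?thesis by (simp add: cos_double_sin)
    qed
    ultimately have "(norm (1 - fchar (axis i 1) u))\<^sup>2 = 4 * (sin (pi * u $ i))\<^sup>2" by simp
    also have "(sin (pi * u $ i))\<^sup>2 = (sin (pi * ?t))\<^sup>2" by (simp add: abs_if)
    finally have eq: "(norm (1 - fchar (axis i 1) u))\<^sup>2 = (2 * sin (pi * ?t))\<^sup>2" by (simp add: power2_eq_square)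
    have "?t \<le> pi * ?t" using pi_gt3 by (simp add: mult_le_cancel_right1)
    also have "\<dots> \<le> 2 * sin (pi * ?t)" using half_le_sin[of "pi * ?t"] t by simp
    finally show ?thesis unfolding eq by (metis abs_ge_zero power2_abs power_mono)
  qed
  ultimately show ?thesis
    unfolding u_def[symmetric] by (simp add: norm_vec_def L2_set_def sum_nonneg torus_gauge_def sum_mono)
qed

text \<open>
  Multiplication of the character sum over the box by \<open>1 - e\<^sub>i\<close> telescopes and leaves only the
  characters from two opposite faces of the box. By Parseval the \<open>i\<close>-th term is thus at most
  \<open>2n\<^sup>d\<^sup>-\<^sup>1/n\<^sup>d\<close>.
\<close>

lemma fejer_concentration:
  assumes n: "n > 0"
  shows "(\<integral>x. fejer n x * torus_gauge x \<partial>(torus_lebesgue :: (real ^ 'n::finite) measure)) \<le> 2 * real CARD('n) / real n"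
proof -
  let ?J = "freq_box n :: (int ^ 'n) set"
  have one: "(\<integral>x. fejer n x * (norm (1 - fchar (axis i 1) x))\<^sup>2 \<partial>torus_lebesgue) \<le> 2 / real n" for i :: 'n
  proof -
    define e :: "int ^ 'n" where "e = axis i 1"
    define J' where "J' = (+) e ` ?J"
    have e: "e $ i = 1" "\<And>j. j \<noteq> i \<Longrightarrow> e $ j = 0" by (auto simp: e_def axis_def)
    have fin: "finite J'" by (simp add: J'_def)
    have cJ: "card J' = card ?J" unfolding J'_def by (intro card_image) simp
    have 1: "card (?J - J') \<le> n ^ (CARD('n) - 1)"
    proof -
      have "?J - J' \<subseteq> {k \<in> ?J. k $ i = 0}"
      proof
        fix k assume k: "k \<in> ?J - J'"
        have "k $ i = 0"
        proof (rule ccontr)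
          assume k0: "k $ i \<noteq> 0"
          have "(k - e) $ j \<in> {0..<int n}" for j
            using k k0 e by (cases "j = i") (auto simp: freq_box_def dest!: spec[of _ j])
          then have "k - e \<in> ?J" by (simp add: freq_box_def)
          then have "k \<in> J'" unfolding J'_def by (intro image_eqI[of _ _ "k - e"]) simp_all
          with k show False by simp
        qed
        with k show "k \<in> {k \<in> ?J. k $ i = 0}" by simp
      qed
      then have "card (?J - J') \<le> card {k \<in> ?J. k $ i = 0}" by (intro card_mono) auto
      also have "\<dots> \<le> n ^ (CARD('n) - 1)" by (rule card_freq_box_face)
      finally show ?thesis .
    qed
    have 2: "card (J' - ?J) = card (?J - J')"
      using cJ card_Diff_subset_Int[of J' ?J] card_Diff_subset_Int[of ?J J'] fin by (simp add: Int_commute)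
    define a :: "int ^ 'n \<Rightarrow> complex" where "a k = (if k \<in> ?J then 1 else -1)" for k
    define D where "D = (?J - J') \<union> (J' - ?J)"
    have tele: "(\<Sum>k\<in>?J. fchar k x) * (1 - fchar e x) = (\<Sum>k\<in>D. a k * fchar k x)" for x
    proof -
      have "(\<Sum>k\<in>?J. fchar k x) * fchar e x = (\<Sum>k\<in>J'. fchar k x)"
        unfolding J'_def by (subst sum.reindex) (auto simp: fchar_add_left sum_distrib_left mult.commute)
      then have "(\<Sum>k\<in>?J. fchar k x) * (1 - fchar e x) = (\<Sum>k\<in>?J. fchar k x) - (\<Sum>k\<in>J'. fchar k x)"
        by (simp add: algebra_simps)
      moreover have "(\<Sum>k\<in>?J. fchar k x) = (\<Sum>k\<in>?J - J'. fchar k x) + (\<Sum>k\<in>?J \<inter> J'. fchar k x)"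
        by (subst sum.union_disjoint[symmetric]) (auto intro!: sum.cong)
      moreover have "(\<Sum>k\<in>J'. fchar k x) = (\<Sum>k\<in>J' - ?J. fchar k x) + (\<Sum>k\<in>?J \<inter> J'. fchar k x)"
        using fin by (subst sum.union_disjoint[symmetric]) (auto intro!: sum.cong)
      ultimately have "(\<Sum>k\<in>?J. fchar k x) * (1 - fchar e x)
         = (\<Sum>k\<in>?J - J'. a k * fchar k x) + (\<Sum>k\<in>J' - ?J. a k * fchar k x)"
        by (simp add: a_def sum_negf)
      also have "\<dots> = (\<Sum>k\<in>D. a k * fchar k x)"
        unfolding D_def using fin by (subst sum.union_disjoint) auto
      finally show ?thesis .
    qed
    have "(\<integral>x. fejer n x * (norm (1 - fchar (axis i 1) x))\<^sup>2 \<partial>torus_lebesgue)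
        = (\<integral>x. (norm (\<Sum>k\<in>D. a k * fchar k x))\<^sup>2 / real (n ^ CARD('n)) \<partial>torus_lebesgue)"
      by (simp add: fejer_def tele[symmetric] norm_mult power_mult_distrib e_def)
    also have "\<dots> = real (card D) / real (n ^ CARD('n))"
    proof -
      have "finite D" "norm (a k) = 1" for k using fin by (auto simp: D_def a_def)
      then show ?thesis using trig_sum_parseval[of D a] by simp
    qed
    also have "\<dots> \<le> real (2 * n ^ (CARD('n) - 1)) / real (n ^ CARD('n))"
      using 1 2 card_Un_le[of "?J - J'" "J' - ?J"] unfolding D_def
      by (intro divide_right_mono of_nat_mono) auto
    also have "\<dots> = 2 / real n"
      using n power_minus_mult[of "CARD('n)" "real n"] by (simp add: field_simps)
    finally show ?thesis .
  qed
  have int: "integrable torus_lebesgue (\<lambda>x. fejer n x * (norm (1 - fchar (axis i 1) x))\<^sup>2)" for i :: 'n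
  proof (rule integrable_torus_bounded)
    fix x :: "real ^ 'n"
    have "norm (1 - fchar (axis i 1) x) \<le> 2" 
      using norm_triangle_ineq4[of 1 "fchar (axis i 1) x"] by simp
    then have "(norm (1 - fchar (axis i 1) x))\<^sup>2 \<le> 2\<^sup>2" by (rule power_mono) simp
    then show "norm (fejer n x * (norm (1 - fchar (axis i 1) x))\<^sup>2) \<le> real (n ^ CARD('n)) * 2\<^sup>2"
      using fejer_le[of n x] fejer_nonneg[of n x] unfolding norm_mult by (intro mult_mono) auto
  qed measurable
  have "(\<integral>x. fejer n x * torus_gauge x \<partial>(torus_lebesgue :: (real ^ 'n) measure))
     = (\<Sum>i\<in>UNIV. \<integral>x. fejer n x * (norm (1 - fchar (axis i 1) x))\<^sup>2 \<partial>(torus_lebesgue :: (real ^ 'n) measure))"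
    unfolding torus_gauge_def sum_distrib_left by (simp add: int)
  also have "\<dots> \<le> (\<Sum>i\<in>(UNIV :: 'n set). 2 / real n)" by (intro sum_mono one)
  finally show ?thesis by (simp add: mult.commute)
qed


lemma fejer_char_expansion:
  "complex_of_real (fejer n (y - x))
     = (\<Sum>k\<in>freq_box n. \<Sum>l\<in>freq_box n. fchar (k - l) y * cnj (fchar (k - l) x)) / of_nat (n ^ CARD('n))"
  for x y :: "real ^ 'n::finite"
  using trig_sum_norm_sq[where S = "freq_box n" and a = "\<lambda>_. 1" and x = "y - x"]
  by (simp add: fejer_def fchar_diff_right)

definition fourier_coeff :: "(real ^ 'n::finite \<Rightarrow> real) \<Rightarrow> int ^ 'n \<Rightarrow> complex" where
  "fourier_coeff h k = (\<integral>x. of_real (h x) * fchar k x \<partial>torus_lebesgue)"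

definition fejer_mean :: "(real ^ 'n::finite \<Rightarrow> real) \<Rightarrow> nat \<Rightarrow> real ^ 'n \<Rightarrow> real" where
  "fejer_mean h n x = (\<integral>y. h y * fejer n (y - x) \<partial>torus_lebesgue)"

context
  fixes h :: "real ^ 'n::finite \<Rightarrow> real" and B :: real
  assumes meas [measurable]: "h \<in> borel_measurable borel"
    and bounded: "\<And>x. \<bar>h x\<bar> \<le> B"
    and per: "\<And>x m. m \<in> int_lattice \<Longrightarrow> h (x + m) = h x"
begin

lemma integrable_times_fchar: "integrable torus_lebesgue (\<lambda>x. z * (of_real (h x) * fchar k x))"
proof (rule integrable_torus_bounded)
  show "norm (z * (of_real (h x) * fchar k x)) \<le> norm z * B" for x
    using bounded by (auto simp: norm_mult intro!: mult_left_mono)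
qed measurable

lemma fejer_mean_expansion:
  "complex_of_real (fejer_mean h n x)
    = (\<Sum>k\<in>freq_box n. \<Sum>l\<in>freq_box n. fourier_coeff h (k - l) * cnj (fchar (k - l) x)) / of_nat (n ^ CARD('n))"
proof -
  have "complex_of_real (fejer_mean h n x) = (\<integral>y. of_real (h y) * of_real (fejer n (y - x)) \<partial>torus_lebesgue)"
    unfolding fejer_mean_def by (simp add: integral_complex_of_real[symmetric])
  also have "\<dots> = (\<integral>y. (\<Sum>k\<in>freq_box n. \<Sum>l\<in>freq_box n. cnj (fchar (k - l) x) / of_nat (n ^ CARD('n)) * (of_real (h y) * fchar (k - l) y)) \<partial>torus_lebesgue)"
    unfolding fejer_char_expansion sum_distrib_left sum_divide_distrib
    by (intro Bochner_Integration.integral_cong refl sum.cong) simp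
  also have "\<dots> = (\<Sum>k\<in>freq_box n. \<Sum>l\<in>freq_box n. cnj (fchar (k - l) x) / of_nat (n ^ CARD('n)) * fourier_coeff h (k - l))"
    unfolding fourier_coeff_def
    by (simp add: Bochner_Integration.integral_sum Bochner_Integration.integrable_sum integrable_times_fchar del: of_nat_power)
  finally show ?thesis unfolding sum_divide_distrib by (simp add: mult.commute)
qed

lemma fejer_mean_measurable [measurable]: "fejer_mean h n \<in> borel_measurable borel"
proof -
  have "fejer_mean h n = (\<lambda>x. Re (complex_of_real (fejer_mean h n x)))" by simp
  also have "\<dots> \<in> borel_measurable borel" unfolding fejer_mean_expansion divide_inverse
    by (intro borel_measurable_continuous_onI continuous_intros continuous_on_fchar)
  finally show ?thesis .
qed

lemma integrable_shifted:
  fixes g :: "real ^ 'n \<Rightarrow> real"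
  assumes [measurable]: "g \<in> borel_measurable borel" and "\<And>y. \<bar>g y\<bar> \<le> C"
  shows "integrable torus_lebesgue (\<lambda>y. g y * fejer n (y - x))"
proof (rule integrable_torus_bounded)
  have C: "0 \<le> C" using assms(2)[of 0] by linarith
  show "norm (g y * fejer n (y - x)) \<le> C * real (n ^ CARD('n))" for y
    using assms(2)[of y] fejer_le[of n "y - x"] fejer_nonneg[of n "y - x"] C unfolding real_norm_def abs_mult
    by (intro mult_mono) auto
qed measurable

lemma fejer_shift_integral:
  assumes "n > 0" shows "(\<integral>y. fejer n (y - x) \<partial>(torus_lebesgue :: (real ^ 'n) measure)) = 1"
  using torus_integral_translate[of "fejer n :: real ^ 'n \<Rightarrow> real" "- x"] fejer_integral[OF assms]
  by (simp add: fejer_periodic)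

lemma fejer_mean_bounded:
  assumes "n > 0" shows "\<bar>fejer_mean h n x\<bar> \<le> B"
proof -
  have "\<bar>fejer_mean h n x\<bar> \<le> (\<integral>y. B * fejer n (y - x) \<partial>torus_lebesgue)"
    unfolding fejer_mean_def
    by (intro order.trans[OF integral_abs_bound] integral_mono integrable_abs integrable_shifted[where C = "\<bar>B\<bar>"]
          integrable_shifted[where C = B] bounded meas)
       (auto simp: abs_mult fejer_nonneg intro!: mult_right_mono bounded)
  also have "\<dots> = B" using fejer_shift_integral[OF assms] by simp
  finally show ?thesis .
qed

text \<open>
  Near \<open>x\<close> modulo the lattice \<open>h\<close> is close to \<open>h x\<close>, and elsewhere the gauge is at least \<open>\<delta>\<^sup>2\<close>. So
  the deviation of \<open>h\<close> from \<open>h x\<close> is bounded everywhere by a small constant plus a multiple of the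
  gauge, and the mean of the gauge under the Fejer kernel tends to zero.
\<close>

lemma fejer_mean_tendsto:
  assumes "isCont h x"
  shows "(\<lambda>n. fejer_mean h n x) \<longlonglongrightarrow> h x"
proof (rule LIMSEQ_I)
  fix \<eta> :: real assume "\<eta> > 0"
  then have "\<eta> / 2 > 0" by simp
  then obtain \<delta> where "\<delta> > 0" and d: "\<forall>y. y \<noteq> x \<and> dist y x < \<delta> \<longrightarrow> dist (h y) (h x) < \<eta> / 2"
    using assms unfolding isCont_def LIM_def by blast
  have \<delta>: "\<delta> > 0" "\<And>y. norm (y - x) < \<delta> \<Longrightarrow> \<bar>h y - h x\<bar> < \<eta> / 2"
  proof -
    fix y assume "norm (y - x) < \<delta>"
    then show "\<bar>h y - h x\<bar> < \<eta> / 2"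
      using d[rule_format, of y] \<open>\<eta> / 2 > 0\<close> by (cases "y = x") (auto simp: dist_norm)
  qed fact
  have B: "B \<ge> 0" using bounded[of 0] by linarith
  have loc: "\<bar>h y - h x\<bar> \<le> \<eta> / 2 + 2 * B / \<delta>\<^sup>2 * torus_gauge (y - x)" for y
  proof -
    define u where "u = torus_rep (y - x)"
    have "h (x + u) = h y"
      using per[OF torus_rep_diff_int_lattice[of "y - x"], of y] by (simp add: u_def algebra_simps)
    have g: "0 \<le> torus_gauge (y - x)" by (rule torus_gauge_nonneg)
    show ?thesis
    proof (cases "norm u < \<delta>")
      case True
      then have "\<bar>h y - h x\<bar> < \<eta> / 2" using \<delta>(2)[of "x + u"] \<open>h (x + u) = h y\<close> by simp
      moreover have "0 \<le> 2 * B / \<delta>\<^sup>2 * torus_gauge (y - x)" using g B by simp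
      ultimately show ?thesis by linarith
    next
      case False
      then have "\<delta>\<^sup>2 \<le> (norm u)\<^sup>2" using \<delta>(1) by (intro power_mono) auto
      also have "\<dots> \<le> torus_gauge (y - x)" unfolding u_def by (rule norm_torus_rep_le_gauge)
      finally have "1 \<le> torus_gauge (y - x) / \<delta>\<^sup>2" using \<delta>(1) by simp
      then have "2 * B * 1 \<le> 2 * B * (torus_gauge (y - x) / \<delta>\<^sup>2)" using B by (intro mult_left_mono) auto
      moreover have "\<bar>h y - h x\<bar> \<le> 2 * B" using bounded[of x] bounded[of y] by linarith
      ultimately show ?thesis using \<open>\<eta> > 0\<close> by simp
    qed
  qed
  define R where "R = 2 * B / \<delta>\<^sup>2 * (2 * real CARD('n))"
  have est: "\<bar>fejer_mean h n x - h x\<bar> \<le> \<eta> / 2 + R / real n" if n: "n > 0" for n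
  proof -
    note int = integrable_shifted[of _ _ n x]
    have g: "integrable torus_lebesgue (\<lambda>y. torus_gauge (y - x) * fejer n (y - x))"
    proof (rule int[where C = "4 * real CARD('n)"])
      show "\<bar>torus_gauge (y - x)\<bar> \<le> 4 * real CARD('n)" for y
        using torus_gauge_le[of "y - x"] torus_gauge_nonneg[of "y - x"] by linarith
    qed measurable
    have "fejer_mean h n x - h x = (\<integral>y. h y * fejer n (y - x) \<partial>torus_lebesgue) - (\<integral>y. h x * fejer n (y - x) \<partial>torus_lebesgue)"
      using fejer_shift_integral[OF n] by (simp add: fejer_mean_def)
    also have "\<dots> = (\<integral>y. (h y - h x) * fejer n (y - x) \<partial>torus_lebesgue)"
      unfolding left_diff_distrib
      by (intro Bochner_Integration.integral_diff[symmetric] int[where C = B] bounded) auto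
    also have "\<bar>\<dots>\<bar> \<le> (\<integral>y. \<eta> / 2 * fejer n (y - x) + 2 * B / \<delta>\<^sup>2 * (torus_gauge (y - x) * fejer n (y - x)) \<partial>torus_lebesgue)"
    proof (intro order.trans[OF integral_abs_bound] integral_mono integrable_abs Bochner_Integration.integrable_add)
      show "integrable torus_lebesgue (\<lambda>y. (h y - h x) * fejer n (y - x))"
      proof (rule int[where C = "2 * B"])
        show "\<bar>h y - h x\<bar> \<le> 2 * B" for y
          using bounded[of x] bounded[of y] by linarith
      qed measurable
      show "integrable torus_lebesgue (\<lambda>y. \<eta> / 2 * fejer n (y - x))"
        by (rule int[where C = "\<bar>\<eta> / 2\<bar>"]) auto
      show "integrable torus_lebesgue (\<lambda>y. 2 * B / \<delta>\<^sup>2 * (torus_gauge (y - x) * fejer n (y - x)))"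
        by (intro integrable_mult_right g)
      show "\<bar>(h y - h x) * fejer n (y - x)\<bar> \<le> \<eta> / 2 * fejer n (y - x) + 2 * B / \<delta>\<^sup>2 * (torus_gauge (y - x) * fejer n (y - x))" for y
        using mult_right_mono[OF loc[of y] fejer_nonneg[of n "y - x"]]
        by (simp add: abs_mult fejer_nonneg distrib_right mult.assoc)
    qed
    also have "\<dots> = \<eta> / 2 * (\<integral>y. fejer n (y - x) \<partial>torus_lebesgue) + 2 * B / \<delta>\<^sup>2 * (\<integral>y. torus_gauge (y - x) * fejer n (y - x) \<partial>torus_lebesgue)"
      using int[of "\<lambda>_. \<eta> / 2" "\<bar>\<eta> / 2\<bar>"] g
      by (subst Bochner_Integration.integral_add) (auto intro!: integrable_mult_right)
    also have "(\<integral>y. torus_gauge (y - x) * fejer n (y - x) \<partial>torus_lebesgue) = (\<integral>y. fejer n y * torus_gauge y \<partial>(torus_lebesgue :: (real ^ 'n) measure))"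
      using torus_integral_translate[of "\<lambda>y :: real ^ 'n. fejer n y * torus_gauge y" "- x"]
      by (simp add: fejer_periodic torus_gauge_periodic mult.commute)
    also have "\<eta> / 2 * (\<integral>y. fejer n (y - x) \<partial>torus_lebesgue) = \<eta> / 2" using fejer_shift_integral[OF n] by simp
    also have "2 * B / \<delta>\<^sup>2 * (\<integral>y. fejer n y * torus_gauge y \<partial>(torus_lebesgue :: (real ^ 'n) measure)) \<le> 2 * B / \<delta>\<^sup>2 * (2 * real CARD('n) / real n)"
      using B by (intro mult_left_mono fejer_concentration n) auto
    finally show ?thesis by (simp add: R_def)
  qed
  obtain N where N: "real N > 2 * R / \<eta>" using reals_Archimedean2 by blast
  have "\<bar>fejer_mean h n x - h x\<bar> < \<eta>" if "n \<ge> Suc N" for n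
  proof -
    have "2 * R / \<eta> < real n" using N that by linarith
    then have "R / real n < \<eta> / 2" using \<open>\<eta> > 0\<close> that by (simp add: field_simps)
    moreover have "\<bar>fejer_mean h n x - h x\<bar> \<le> \<eta> / 2 + R / real n" using est[of n] that by simp
    ultimately show ?thesis by linarith
  qed
  then show "\<exists>no. \<forall>n\<ge>no. norm (fejer_mean h n x - h x) < \<eta>" by auto
qed

lemma fejer_mean_inner:
  "complex_of_real (\<integral>x. h x * fejer_mean h n x \<partial>torus_lebesgue)
    = of_real ((\<Sum>l\<in>freq_box n. \<Sum>k\<in>freq_box n. (norm (fourier_coeff h (k - l)))\<^sup>2) / real (n ^ CARD('n)))"
proof -
  have cnj_coeff: "(\<integral>x. of_real (h x) * cnj (fchar k x) \<partial>torus_lebesgue) = cnj (fourier_coeff h k)" for k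
    unfolding fourier_coeff_def by (subst Bochner_Integration.integral_cnj[symmetric]) simp
  have int: "integrable torus_lebesgue (\<lambda>x. z * (of_real (h x) * cnj (fchar k x)))" for z k
    using integrable_cnj[OF integrable_times_fchar[of "cnj z" k]] by simp
  have "complex_of_real (\<integral>x. h x * fejer_mean h n x \<partial>torus_lebesgue)
      = (\<integral>x. of_real (h x) * of_real (fejer_mean h n x) \<partial>torus_lebesgue)"
    by (simp add: integral_complex_of_real[symmetric])
  also have "\<dots> = (\<integral>x. (\<Sum>k\<in>freq_box n. \<Sum>l\<in>freq_box n. fourier_coeff h (k - l) / of_nat (n ^ CARD('n)) * (of_real (h x) * cnj (fchar (k - l) x))) \<partial>torus_lebesgue)"
    unfolding fejer_mean_expansion sum_distrib_left sum_divide_distrib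
    by (intro Bochner_Integration.integral_cong refl sum.cong) simp
  also have "\<dots> = (\<Sum>k\<in>freq_box n. \<Sum>l\<in>freq_box n. fourier_coeff h (k - l) / of_nat (n ^ CARD('n)) * cnj (fourier_coeff h (k - l)))"
    unfolding cnj_coeff[symmetric]
    by (simp add: Bochner_Integration.integral_sum Bochner_Integration.integrable_sum int del: of_nat_power)
  also have "\<dots> = of_real ((\<Sum>k\<in>freq_box n. \<Sum>l\<in>freq_box n. (norm (fourier_coeff h (k - l)))\<^sup>2) / real (n ^ CARD('n)))"
    unfolding sum_divide_distrib of_real_sum of_real_divide complex_norm_square by (intro sum.cong refl) simp
  finally show ?thesis by (subst sum.swap)
qed

text \<open>
  The difficult half of Parseval's identity, which contains the completeness of the characters. For
  fixed \<open>l\<close> the differences \<open>k - l\<close> are distinct, so the integral of \<open>h\<close> times its Fejer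
  mean, as expanded in \<open>fejer_mean_inner\<close>, is an average of sums that are at most \<open>C\<close>.
\<close>

lemma fourier_norm_le:
  assumes cont: "AE x in torus_lebesgue. isCont h x"
    and C: "\<And>S. finite S \<Longrightarrow> (\<Sum>k\<in>S. (norm (fourier_coeff h k))\<^sup>2) \<le> C"
  shows "(\<integral>x. (h x)\<^sup>2 \<partial>torus_lebesgue) \<le> C"
proof (rule LIMSEQ_le_const2)
  interpret prob_space "torus_lebesgue :: (real ^ 'n) measure" by (rule prob_space_torus_lebesgue)
  show "(\<lambda>n. \<integral>x. h x * fejer_mean h (Suc n) x \<partial>torus_lebesgue) \<longlonglongrightarrow> (\<integral>x. (h x)\<^sup>2 \<partial>torus_lebesgue)"
  proof (rule integral_dominated_convergence[where w = "\<lambda>_. B * B"])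
    show "AE x in torus_lebesgue. (\<lambda>n. h x * fejer_mean h (Suc n) x) \<longlonglongrightarrow> (h x)\<^sup>2"
      using cont
    proof eventually_elim
      case (elim x)
      have "(\<lambda>n. h x * fejer_mean h (Suc n) x) \<longlonglongrightarrow> h x * h x"
        by (intro tendsto_intros LIMSEQ_Suc fejer_mean_tendsto elim)
      then show ?case by (simp add: power2_eq_square)
    qed
    have "\<bar>h x * fejer_mean h (Suc n) x\<bar> \<le> B * B" for n x
      unfolding abs_mult using bounded[of x] by (intro mult_mono bounded fejer_mean_bounded) auto
    then show "AE x in torus_lebesgue. norm (h x * fejer_mean h (Suc n) x) \<le> B * B" for n by simp
  qed (auto intro: measurable_torus_lebesgue)
  have "(\<integral>x. h x * fejer_mean h (Suc n) x \<partial>torus_lebesgue) \<le> C" for n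
  proof -
    have "(\<Sum>k\<in>freq_box (Suc n). (norm (fourier_coeff h (k - l)))\<^sup>2) \<le> C" for l
      using C[of "(\<lambda>k. k - l) ` freq_box (Suc n)"] by (simp add: sum.reindex inj_on_def)
    then have "(\<Sum>l\<in>freq_box (Suc n). \<Sum>k\<in>freq_box (Suc n). (norm (fourier_coeff h (k - l)))\<^sup>2)
       \<le> (\<Sum>l\<in>(freq_box (Suc n) :: (int ^ 'n) set). C)" by (intro sum_mono)
    then show ?thesis
      using fejer_mean_inner[of "Suc n"] by (simp only: of_real_eq_iff) (simp add: card_freq_box divide_le_eq mult.commute)
  qed
  then show "\<exists>N. \<forall>n\<ge>N. (\<integral>x. h x * fejer_mean h (Suc n) x \<partial>torus_lebesgue) \<le> C" by blast
qed

end

section \<open>Summability over the integer lattice\<close>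

lemma int_powr_sums_bounded:
  fixes p :: real
  assumes p: "1 < p"
  shows "\<exists>A\<ge>0. \<forall>T::int set. finite T \<longrightarrow> (\<Sum>a\<in>T. (1 + \<bar>real_of_int a\<bar>) powr (- p)) \<le> A"
proof -
  define w where "w n = real (Suc n) powr (- p)" for n
  have sm: "summable w"
    unfolding w_def
    by (rule summable_Suc_iff[THEN iffD2]) (use p summable_real_powr_iff[of "- p"] in simp)
  have w0: "w n \<ge> 0" for n by (simp add: w_def)
  have nat: "(\<Sum>a\<in>T. w (nat \<bar>a\<bar>)) \<le> suminf w" if "finite T" "inj_on (\<lambda>a. nat \<bar>a\<bar>) T" for T :: "int set"
  proof -
    have "(\<Sum>a\<in>T. w (nat \<bar>a\<bar>)) = sum w ((\<lambda>a. nat \<bar>a\<bar>) ` T)"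
      using that(2) by (simp add: sum.reindex)
    also have "\<dots> \<le> suminf w" using that(1) w0 by (intro sum_le_suminf sm) auto
    finally show ?thesis .
  qed
  have "(\<Sum>a\<in>T. (1 + \<bar>real_of_int a\<bar>) powr (- p)) \<le> 2 * suminf w" if T: "finite T" for T :: "int set"
  proof -
    have "(\<Sum>a\<in>T. (1 + \<bar>real_of_int a\<bar>) powr (- p)) = (\<Sum>a\<in>T. w (nat \<bar>a\<bar>))"
      by (intro sum.cong refl) (simp add: w_def)
    also have "\<dots> = (\<Sum>a\<in>{a\<in>T. a \<ge> 0}. w (nat \<bar>a\<bar>)) + (\<Sum>a\<in>{a\<in>T. a < 0}. w (nat \<bar>a\<bar>))"
      using T by (subst sum.union_disjoint[symmetric]) (auto intro!: sum.cong)
    also have "\<dots> \<le> suminf w + suminf w"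
      using T by (intro add_mono nat) (auto simp: inj_on_def)
    finally show ?thesis by simp
  qed
  moreover have "0 \<le> 2 * suminf w" using suminf_nonneg[OF sm] w0 by simp
  ultimately show ?thesis by blast
qed

text \<open>
  For \<open>k \<noteq> 0\<close> every \<open>1 + \<bar>k\<^sub>i\<bar>\<close> is at most \<open>2\<bar>k\<bar>\<close>, hence \<open>\<bar>k\<bar>\<^sup>-\<^sup>(\<^sup>d\<^sup>+\<^sup>1\<^sup>)\<close> is dominated by the product of
  the \<open>(1 + \<bar>k\<^sub>i\<bar>)\<^sup>-\<^sup>p\<close> with \<open>p = (d + 1)/d > 1\<close>, and the sum over a box factors into convergent
  one-dimensional sums.
\<close>

lemma int_vec_norm_powr_sums_bounded:
  "\<exists>A\<ge>0. \<forall>S::(int ^ 'n::finite) set. finite S \<longrightarrow> 0 \<notin> S \<longrightarrow>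
     (\<Sum>k\<in>S. norm (of_int_vec k) powr (- (real CARD('n) + 1))) \<le> A"
proof -
  define d where "d = real CARD('n)"
  have d: "d > 0" by (simp add: d_def)
  define p where "p = (d + 1) / d"
  have p: "1 < p" "p * d = d + 1" using d by (auto simp: p_def field_simps)
  obtain A where A: "A \<ge> 0" "\<And>T::int set. finite T \<Longrightarrow> (\<Sum>a\<in>T. (1 + \<bar>real_of_int a\<bar>) powr (- p)) \<le> A"
    using int_powr_sums_bounded[OF p(1)] by blast
  define w where "w a = (1 + \<bar>real_of_int a\<bar>) powr (- p)" for a
  have w0: "w a \<ge> 0" for a by (simp add: w_def)
  have ptw: "norm (of_int_vec k) powr (- (d + 1)) \<le> 2 powr (d + 1) * (\<Prod>i\<in>UNIV. w (k $ i))"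
    if k: "k \<noteq> 0" for k :: "int ^ 'n"
  proof -
    define N where "N = norm (of_int_vec k)"
    have comp: "\<bar>real_of_int (k $ i)\<bar> \<le> N" for i
      using component_le_norm_cart[of "of_int_vec k" i] by (simp add: N_def)
    obtain i where "k $ i \<noteq> 0" using k by (auto simp: vec_eq_iff)
    then have "1 \<le> \<bar>real_of_int (k $ i)\<bar>" by linarith
    then have N1: "1 \<le> N" using comp[of i] by linarith
    have "N powr (- (d + 1)) = 2 powr (d + 1) * (2 * N) powr (- (d + 1))"
    proof -
      have "(2 :: real) powr (d + 1) * 2 powr (- (d + 1)) = 1"
        using powr_add[of "2 :: real" "d + 1" "- (d + 1)"] by simp
      then show ?thesis using N1 powr_mult[of 2 N "- (d + 1)"] by simp
    qed
    also have "(2 * N) powr (- (d + 1)) = (\<Prod>i\<in>(UNIV :: 'n set). (2 * N) powr (- p))"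
      using N1 p(2) by (simp add: powr_powr d_def[symmetric] powr_realpow[symmetric] minus_mult_left[symmetric])
    also have "\<dots> \<le> (\<Prod>i\<in>UNIV. w (k $ i))"
      unfolding w_def
    proof (intro prod_mono conjI)
      fix i
      show "(2 * N) powr (- p) \<le> (1 + \<bar>real_of_int (k $ i)\<bar>) powr (- p)"
        using comp[of i] N1 p(1) by (intro powr_mono2') auto
    qed simp
    finally show ?thesis unfolding N_def by simp
  qed
  have "(\<Sum>k\<in>S. norm (of_int_vec k) powr (- (d + 1))) \<le> 2 powr (d + 1) * A ^ CARD('n)"
    if S: "finite S" "0 \<notin> S" for S :: "(int ^ 'n) set"
  proof -
    define T where "T = (\<Union>i. (\<lambda>k. k $ i) ` S)"
    have T: "finite T" unfolding T_def using S by simp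
    define box where "box = {k :: int ^ 'n. \<forall>i. k $ i \<in> T}"
    have box: "finite box" unfolding box_def using T by (intro finite_int_vec_box)
    have sub: "S \<subseteq> box" by (auto simp: box_def T_def)
    have "(\<Sum>k\<in>S. norm (of_int_vec k) powr (- (d + 1))) \<le> (\<Sum>k\<in>S. 2 powr (d + 1) * (\<Prod>i\<in>UNIV. w (k $ i)))"
      using S by (intro sum_mono ptw) auto
    also have "\<dots> \<le> (\<Sum>k\<in>box. 2 powr (d + 1) * (\<Prod>i\<in>UNIV. w (k $ i)))"
      using w0 by (intro sum_mono2 box sub) (auto intro!: prod_nonneg mult_nonneg_nonneg)
    also have "\<dots> = 2 powr (d + 1) * (\<Sum>k\<in>box. \<Prod>i\<in>UNIV. w (k $ i))"
      by (simp add: sum_distrib_left)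
    also have "(\<Sum>k\<in>box. \<Prod>i\<in>UNIV. w (k $ i)) = (\<Sum>g\<in>Pi\<^sub>E UNIV (\<lambda>_. T). \<Prod>i\<in>(UNIV :: 'n set). w (g i))"
      by (rule sum.reindex_bij_witness[where i = vec_lambda and j = vec_nth]) (auto simp: box_def)
    also have "\<dots> = (\<Prod>i\<in>(UNIV :: 'n set). \<Sum>a\<in>T. w a)"
      using T by (subst prod_sum_PiE) auto
    also have "\<dots> \<le> A ^ CARD('n)"
      using A(2)[OF T] w0 by (simp add: w_def power_mono sum_nonneg)
    finally show ?thesis by (simp add: mult_left_mono)
  qed
  then show ?thesis using A(1) unfolding d_def by (intro exI[of _ "2 powr (real CARD('n) + 1) * A ^ CARD('n)"]) auto
qed

section \<open>The discrepancy of the grid\<close>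

definition near_lattice :: "real \<Rightarrow> (real ^ 'n::finite) set" where
  "near_lattice r = {x. \<exists>m\<in>int_lattice. norm (x + m) \<le> r}"

lemma near_lattice_add_iff:
  fixes x m :: "real ^ 'n::finite"
  assumes "m \<in> int_lattice"
  shows "x + m \<in> near_lattice r \<longleftrightarrow> x \<in> near_lattice r"
proof -
  have "x + m \<in> near_lattice r" if "x \<in> near_lattice r" "m \<in> int_lattice" for x m :: "real ^ 'n"
  proof -
    from that(1) obtain k where k: "k \<in> int_lattice" "norm (x + k) \<le> r" by (auto simp: near_lattice_def)
    then show ?thesis using that(2) unfolding near_lattice_def
      by (intro CollectI bexI[of _ "k - m"]) (auto simp: int_lattice_closed)
  qed
  from this[of x m] this[of "x + m" "- m"] assms show ?thesis by (auto simp: int_lattice_closed)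
qed

lemma closed_int_lattice: "closed (int_lattice :: (real ^ 'n::finite) set)"
proof -
  have eq: "int_lattice = (\<Inter>i. (\<lambda>x :: real ^ 'n. x $ i) -` \<int>)" by (auto simp: int_lattice_def)
  show ?thesis unfolding eq by (intro closed_INT ballI closed_vimage closed_Ints continuous_intros)
qed

text \<open>
  The description by the distance function gives topological control: the set is closed, and its
  boundary lies on countably many spheres.
\<close>

lemma near_lattice_infdist: "near_lattice r = {x :: real ^ 'n::finite. infdist x int_lattice \<le> r}"
proof (intro set_eqI iffI)
  fix x :: "real ^ 'n"
  assume "x \<in> near_lattice r"
  then obtain m where m: "m \<in> int_lattice" "norm (x + m) \<le> r" by (auto simp: near_lattice_def)
  then show "x \<in> {x. infdist x int_lattice \<le> r}"
    by (auto intro!: infdist_le2[of "- m"] simp: int_lattice_closed dist_norm)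
next
  fix x :: "real ^ 'n"
  assume x: "x \<in> {x. infdist x int_lattice \<le> r}"
  have ne: "(int_lattice :: (real ^ 'n) set) \<noteq> {}" using int_lattice_closed(1) by blast
  obtain m where m: "m \<in> int_lattice" "\<And>y. y \<in> int_lattice \<Longrightarrow> dist x m \<le> dist x y"
    using distance_attains_inf[OF closed_int_lattice ne, of x] by metis
  have "dist x m \<le> infdist x int_lattice"
    unfolding infdist_notempty[OF ne] by (intro cINF_greatest ne m)
  then show "x \<in> near_lattice r" using x m(1)
    by (auto simp: near_lattice_def dist_norm int_lattice_closed intro!: bexI[of _ "- m"])
qed

lemma closed_near_lattice: "closed (near_lattice r :: (real ^ 'n::finite) set)"
  unfolding near_lattice_infdist by (intro closed_Collect_le continuous_intros)

lemma near_lattice_measurable [measurable]: "near_lattice r \<in> sets (borel :: (real ^ 'n::finite) measure)"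
  by (intro borel_closed closed_near_lattice)

lemma frontier_near_lattice_null: "frontier (near_lattice r) \<in> null_sets (lborel :: (real ^ 'n::finite) measure)"
proof -
  have op: "open {x :: real ^ 'n. infdist x int_lattice < r}" by (intro open_Collect_less continuous_intros)
  have "{x :: real ^ 'n. infdist x int_lattice < r} \<subseteq> interior (near_lattice r)"
    by (rule interior_maximal) (auto simp: near_lattice_infdist op)
  then have sub: "frontier (near_lattice r) \<subseteq> (\<Union>m\<in>int_lattice. sphere (m :: real ^ 'n) r)"
  proof -
    assume int: "{x :: real ^ 'n. infdist x int_lattice < r} \<subseteq> interior (near_lattice r)"
    show ?thesis
    proof
      fix x :: "real ^ 'n" assume "x \<in> frontier (near_lattice r)"
      then have x: "x \<in> near_lattice r" "\<not> infdist x int_lattice < r"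
        using int closed_near_lattice[of r, where 'n = 'n] by (auto simp: frontier_def closure_closed)
      then obtain m where m: "m \<in> int_lattice" "norm (x + m) \<le> r" by (auto simp: near_lattice_def)
      have "infdist x int_lattice \<le> dist x (- m)" by (intro infdist_le int_lattice_closed m)
      then have "dist x (- m) = r" using x m by (simp add: dist_norm)
      then show "x \<in> (\<Union>m\<in>int_lattice. sphere m r)"
        using m by (intro UN_I[of "- m"]) (auto simp: int_lattice_closed dist_commute)
    qed
  qed
  have "sphere (m :: real ^ 'n) r \<in> null_sets lborel" for m
    using negligible_sphere[of m r] by (auto simp: null_sets_completion_iff negligible_iff_null_sets)
  then have "(\<Union>m\<in>int_lattice. sphere (m :: real ^ 'n) r) \<in> null_sets lborel"
    by (intro null_sets_UN' countable_int_lattice)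
  then show ?thesis by (rule null_sets_subset) (use sub in auto)
qed

text \<open>
  This is where \<open>r < 1/2\<close> enters: the ball fits into the fundamental cube, so its images under the
  lattice do not overlap.
\<close>

lemma near_lattice_torus:
  fixes x :: "real ^ 'n::finite"
  assumes r: "r < 1 / 2"
  shows "x \<in> torus \<and> x \<in> near_lattice r \<longleftrightarrow> x \<in> cball 0 r"
proof -
  have in_torus: "y \<in> torus" if "norm y \<le> r" for y :: "real ^ 'n"
  proof -
    have "- 1 / 2 \<le> y $ i \<and> y $ i < 1 / 2" for i
      using component_le_norm_cart[of y i] that r by linarith
    then show ?thesis by (simp add: torus_def)
  qed
  show ?thesis
  proof
    assume x: "x \<in> torus \<and> x \<in> near_lattice r"
    then obtain m where m: "m \<in> int_lattice" "norm (x + m) \<le> r" by (auto simp: near_lattice_def)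
    then have "m = 0" using x in_torus by (intro torus_add_lattice_unique[of x]) auto
    then show "x \<in> cball 0 r" using m by simp
  next
    assume "x \<in> cball 0 r"
    then show "x \<in> torus \<and> x \<in> near_lattice r"
      using in_torus[of x] int_lattice_closed(1) by (auto simp: near_lattice_def intro!: bexI[of _ 0])
  qed
qed

lemma near_lattice_fourier:
  assumes r: "r < 1 / 2"
  shows "(\<integral>x. indicator (near_lattice r) x *\<^sub>R fchar k x \<partial>torus_lebesgue)
    = (\<integral>x. indicator (cball 0 r) x *\<^sub>R cis (2 * pi * (of_int_vec k \<bullet> x)) \<partial>lborel)"
proof -
  have "(\<integral>x. indicator (near_lattice r) x *\<^sub>R fchar k x \<partial>torus_lebesgue)
     = (\<integral>x. indicator torus x *\<^sub>R (indicator (near_lattice r) x *\<^sub>R fchar k x) \<partial>lborel)"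
    unfolding torus_lebesgue_def by (subst integral_restrict_space) auto
  also have "\<dots> = (\<integral>x. indicator (cball 0 r) x *\<^sub>R cis (2 * pi * (of_int_vec k \<bullet> x)) \<partial>lborel)"
    using near_lattice_torus[OF r] by (intro Bochner_Integration.integral_cong) (auto simp: indicator_def fchar_def)
  finally show ?thesis .
qed

lemma grid_alt: "s \<in> grid M \<longleftrightarrow> s \<in> torus \<and> (\<exists>k\<in>int_lattice. s = (1 / real M) *\<^sub>R k)"
  by (auto simp: grid_def)

text \<open>
  The grid is a system of representatives of \<open>(1/M)\<int>\<^sup>d\<close> modulo \<open>\<int>\<^sup>d\<close>.
\<close>

lemma torus_rep_scaled_lattice:
  assumes M: "M > 0" and k: "k \<in> int_lattice"
  shows "torus_rep ((1 / real M) *\<^sub>R k) \<in> grid M"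
proof -
  define x where "x = (1 / real M) *\<^sub>R k"
  have "real M *\<^sub>R (torus_rep x - x) \<in> int_lattice"
    using torus_rep_diff_int_lattice[of x] by (auto simp: int_lattice_def)
  then have "k + real M *\<^sub>R (torus_rep x - x) \<in> int_lattice" by (intro int_lattice_closed k)
  moreover have "torus_rep x = (1 / real M) *\<^sub>R (k + real M *\<^sub>R (torus_rep x - x))"
    using M by (simp add: scaleR_add_right x_def)
  ultimately show ?thesis unfolding x_def[symmetric] grid_alt using torus_rep_in_torus by blast
qed

definition grid_discrepancy :: "real \<Rightarrow> nat \<Rightarrow> real ^ 'n::finite \<Rightarrow> real" where
  "grid_discrepancy r M t = (\<Sum>s\<in>grid M. indicator (near_lattice r) (t - s))
      - real (card (grid M :: (real ^ 'n) set)) * r ^ CARD('n) * measure lborel (cball 0 1 :: (real ^ 'n) set)"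

lemma grid_discrepancy_eq:
  "discrepancy r (grid M) (\<lambda>s. torus_rep (- s)) = (grid_discrepancy r M :: real ^ 'n::finite \<Rightarrow> real)"
proof
  fix t :: "real ^ 'n"
  have "indicator (torus_ball (- t) r) (torus_rep (- s)) = (indicator (near_lattice r) (t - s) :: real)" for s
  proof -
    have "torus_rep (- s) \<in> torus_ball (- t) r \<longleftrightarrow> torus_rep (- s) + t \<in> near_lattice r"
      by (simp add: mem_torus_ball_uminus_iff torus_rep_in_torus near_lattice_def)
    also have "torus_rep (- s) + t = (t - s) + (torus_rep (- s) - (- s))" by simp
    also have "\<dots> \<in> near_lattice r \<longleftrightarrow> t - s \<in> near_lattice r"
      by (intro near_lattice_add_iff torus_rep_diff_int_lattice)
    finally show ?thesis by (simp add: indicator_def)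
  qed
  then show "discrepancy r (grid M) (\<lambda>s. torus_rep (- s)) t = grid_discrepancy r M t"
    by (simp add: discrepancy_def grid_discrepancy_def)
qed

lemma grid_discrepancy_measurable [measurable]: "grid_discrepancy r M \<in> borel_measurable borel"
  unfolding grid_discrepancy_def by measurable

lemma grid_discrepancy_periodic:
  "m \<in> int_lattice \<Longrightarrow> grid_discrepancy r M (t + m) = grid_discrepancy r M t"
  using near_lattice_add_iff[of m "t - s" r for s]
  by (auto simp: grid_discrepancy_def indicator_def algebra_simps intro!: sum.cong)

text \<open>
  Shifting \<open>t\<close> by a point of \<open>(1/M)\<int>\<^sup>d\<close> only permutes the grid points modulo \<open>\<int>\<^sup>d\<close>.
\<close>

lemma grid_discrepancy_grid_periodic:
  fixes t :: "real ^ 'n::finite"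
  assumes M: "M > 0" and k: "k \<in> int_lattice"
  shows "grid_discrepancy r M (t + (1 / real M) *\<^sub>R k) = grid_discrepancy r M t"
proof -
  define s0 where "s0 = (1 / real M) *\<^sub>R k"
  have rep: "torus_rep (s + (1 / real M) *\<^sub>R l) \<in> grid M" if "s \<in> grid M" "l \<in> int_lattice" for s l :: "real ^ 'n"
    using that torus_rep_scaled_lattice[OF M, of "_ + l"] by (auto simp: grid_alt int_lattice_closed scaleR_add_right[symmetric])
  have inv: "torus_rep (torus_rep (s + a) - a) = s" "torus_rep (torus_rep (s - a) + a) = s" if "s \<in> grid M" for s a :: "real ^ 'n"
  proof -
    have s: "s \<in> torus" using that by (simp add: grid_alt)
    have "s - (torus_rep (s + a) - a) = - (torus_rep (s + a) - (s + a))" "s - (torus_rep (s - a) + a) = - (torus_rep (s - a) - (s - a))"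
      by simp_all
    then show "torus_rep (torus_rep (s + a) - a) = s" "torus_rep (torus_rep (s - a) + a) = s"
      by (intro torus_rep_eqI[OF s]; simp only: int_lattice_closed(4) torus_rep_diff_int_lattice)+
  qed
  have "(\<Sum>s\<in>grid M. indicator (near_lattice r) (t + s0 - s)) = (\<Sum>s\<in>grid M. indicator (near_lattice r) (t - s) :: real)"
  proof (rule sum.reindex_bij_witness[where i = "\<lambda>s. torus_rep (s + s0)" and j = "\<lambda>s. torus_rep (s - s0)"])
    fix s :: "real ^ 'n" assume s: "s \<in> grid M"
    show "torus_rep (torus_rep (s - s0) + s0) = s" "torus_rep (torus_rep (s + s0) - s0) = s" using inv s by auto
    show "torus_rep (s + s0) \<in> grid M" "torus_rep (s - s0) \<in> grid M"
      using rep[OF s k] rep[OF s int_lattice_closed(4)[OF k]] by (simp_all add: s0_def)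
    have "t - torus_rep (s - s0) = (t + s0 - s) + - (torus_rep (s - s0) - (s - s0))" by simp
    also have "\<dots> \<in> near_lattice r \<longleftrightarrow> t + s0 - s \<in> near_lattice r"
      by (intro near_lattice_add_iff int_lattice_closed torus_rep_diff_int_lattice)
    finally show "indicator (near_lattice r) (t - torus_rep (s - s0)) = (indicator (near_lattice r) (t + s0 - s) :: real)"
      by (simp add: indicator_def)
  qed
  then show ?thesis by (simp add: grid_discrepancy_def s0_def)
qed

lemma grid_discrepancy_bounded:
  "\<exists>B. \<forall>t::real ^ 'n::finite. \<bar>grid_discrepancy r M t\<bar> \<le> B"
proof -
  let ?c = "real (card (grid M :: (real ^ 'n) set)) * r ^ CARD('n) * measure lborel (cball 0 1 :: (real ^ 'n) set)"
  have "\<bar>grid_discrepancy r M t\<bar> \<le> real (card (grid M :: (real ^ 'n) set)) + \<bar>?c\<bar>" for t :: "real ^ 'n"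
  proof -
    have "\<bar>\<Sum>s\<in>grid M. indicator (near_lattice r) (t - s) :: real\<bar> \<le> (\<Sum>s\<in>(grid M :: (real ^ 'n) set). 1)"
      by (intro order.trans[OF sum_abs] sum_mono) (auto simp: indicator_def)
    then have "\<bar>\<Sum>s\<in>grid M. indicator (near_lattice r) (t - s) :: real\<bar> \<le> real (card (grid M :: (real ^ 'n) set))" by simp
    then show ?thesis unfolding grid_discrepancy_def by linarith
  qed
  then show ?thesis by blast
qed

lemma finite_grid:
  assumes "M > 0" shows "finite (grid M :: (real ^ 'n::finite) set)"
  using card_grid[OF assms, where 'n = 'n] assms by (metis card.infinite power_eq_0_iff not_gr0)

lemma grid_discrepancy_continuous_AE:
  assumes "M > 0"
  shows "AE t in torus_lebesgue. isCont (grid_discrepancy r M :: real ^ 'n::finite \<Rightarrow> real) t"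
proof -
  have "AE t in lborel. t - s \<notin> frontier (near_lattice r)" for s :: "real ^ 'n"
  proof -
    have eq: "distr lborel borel ((+) (- s)) = lborel" by (rule lborel_distr_plus)
    have "AE t in distr lborel borel ((+) (- s)). t \<notin> frontier (near_lattice r)"
      unfolding eq by (rule AE_not_in) (rule frontier_near_lattice_null)
    moreover have "- frontier (near_lattice r :: (real ^ 'n) set) \<in> sets borel"
      by (intro borel_open) (simp add: open_Compl)
    ultimately show ?thesis by (subst (asm) AE_distr_iff) (auto simp: Compl_eq[symmetric])
  qed
  then have "AE t in lborel. \<forall>s\<in>grid M. t - s \<notin> frontier (near_lattice r :: (real ^ 'n) set)"
    using finite_grid[OF assms] by (intro AE_finite_allI) auto
  then have "AE t in torus_lebesgue. \<forall>s\<in>grid M. t - s \<notin> frontier (near_lattice r :: (real ^ 'n) set)"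
    unfolding torus_lebesgue_def by (subst AE_restrict_space_iff) auto
  then show ?thesis
  proof eventually_elim
    case (elim t)
    have "isCont (\<lambda>t. indicator (near_lattice r) (t - s) :: real) t" if "s \<in> grid M" for s
    proof (rule isCont_o2[where f = "\<lambda>t. t - s"])
      show "isCont (indicator (near_lattice r) :: real ^ 'n \<Rightarrow> real) (t - s)"
        using elim that by (simp add: isCont_indicator)
    qed (intro continuous_intros)
    then show ?case unfolding grid_discrepancy_def by (intro continuous_intros) auto
  qed
qed

text \<open>
  A translation multiplies a Fourier coefficient by the value of the character.
\<close>

lemma near_lattice_shift_fourier:
  fixes k :: "int ^ 'n::finite"
  shows "(\<integral>t. indicator (near_lattice r) (t - s) *\<^sub>R fchar k t \<partial>torus_lebesgue)
    = fchar k s * (\<integral>t. indicator (near_lattice r) t *\<^sub>R fchar k t \<partial>torus_lebesgue)"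
proof -
  let ?h = "\<lambda>t. indicator (near_lattice r) t *\<^sub>R fchar k t :: complex"
  have "(\<integral>t. indicator (near_lattice r) (t - s) *\<^sub>R fchar k t \<partial>torus_lebesgue)
      = (\<integral>t. fchar k s * ?h (t + - s) \<partial>torus_lebesgue)"
  proof (intro Bochner_Integration.integral_cong refl)
    fix t
    show "indicator (near_lattice r) (t - s) *\<^sub>R fchar k t = fchar k s * ?h (t + - s)"
      using fchar_add_right[of k s "t - s"] by (simp add: scaleR_conv_of_real)
  qed
  also have "\<dots> = fchar k s * (\<integral>t. ?h (t + - s) \<partial>torus_lebesgue)" by (rule integral_mult_right_zero)
  also have "(\<integral>t. ?h (t + - s) \<partial>torus_lebesgue) = (\<integral>t. ?h t \<partial>torus_lebesgue)"
    by (rule torus_integral_translate) (auto simp: near_lattice_add_iff fchar_periodic indicator_def)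
  finally show ?thesis .
qed

lemma grid_discrepancy_coeff:
  fixes k :: "int ^ 'n::finite"
  assumes M: "M > 0"
  shows "fourier_coeff (grid_discrepancy r M) k
     = (\<Sum>s\<in>grid M. fchar k s) * (\<integral>t. indicator (near_lattice r) t *\<^sub>R fchar k t \<partial>torus_lebesgue)
       - (if k = 0 then of_real (real (M ^ CARD('n)) * r ^ CARD('n) * measure lborel (cball 0 1 :: (real ^ 'n) set)) else 0)"
proof -
  define c where "c = real (M ^ CARD('n)) * r ^ CARD('n) * measure lborel (cball 0 1 :: (real ^ 'n) set)"
  have "fourier_coeff (grid_discrepancy r M) k
     = (\<integral>t. (\<Sum>s\<in>grid M. indicator (near_lattice r) (t - s) *\<^sub>R fchar k t) - of_real c * fchar k t \<partial>torus_lebesgue)"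
    unfolding fourier_coeff_def grid_discrepancy_def card_grid[OF M] c_def[symmetric]
    by (intro Bochner_Integration.integral_cong refl) (simp add: scaleR_conv_of_real sum_distrib_right left_diff_distrib)
  also have "\<dots> = (\<Sum>s\<in>grid M. \<integral>t. indicator (near_lattice r) (t - s) *\<^sub>R fchar k t \<partial>torus_lebesgue)
      - of_real c * (\<integral>t. fchar k t \<partial>torus_lebesgue)"
  proof -
    have i1: "integrable torus_lebesgue (\<lambda>t. indicator (near_lattice r) (t - s) *\<^sub>R fchar k t)" for s
      by (rule integrable_torus_bounded[where B = 1]) (auto simp: indicator_def)
    have i2: "integrable torus_lebesgue (\<lambda>t. of_real c * fchar k t)"
      by (rule integrable_torus_bounded[where B = "\<bar>c\<bar>"]) (auto simp: norm_mult)
    show ?thesis by (simp add: i1 i2 Bochner_Integration.integral_diff Bochner_Integration.integrable_sum)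
  qed
  also have "\<dots> = (\<Sum>s\<in>grid M. fchar k s) * (\<integral>t. indicator (near_lattice r) t *\<^sub>R fchar k t \<partial>torus_lebesgue)
       - (if k = 0 then of_real c else 0)"
    by (simp add: near_lattice_shift_fourier fchar_orthogonal sum_distrib_right)
  finally show ?thesis by (simp add: c_def)
qed

lemma grid_discrepancy_coeff_0:
  assumes M: "M > 0" and r: "0 < r" "r < 1 / 2"
  shows "fourier_coeff (grid_discrepancy r M :: real ^ 'n::finite \<Rightarrow> real) 0 = 0"
proof -
  have "(\<integral>t. indicator (near_lattice r) t *\<^sub>R fchar (0 :: int ^ 'n) t \<partial>torus_lebesgue)
      = (\<integral>t. complex_of_real (indicator (cball 0 r :: (real ^ 'n) set) t) \<partial>lborel)"
    by (subst near_lattice_fourier[OF r(2)]) (simp add: scaleR_conv_of_real)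
  also have "\<dots> = of_real (measure lborel (cball 0 r :: (real ^ 'n) set))"
    by (simp add: integral_complex_of_real)
  also have "measure lborel (cball 0 r :: (real ^ 'n) set) = r ^ CARD('n) * measure lborel (cball 0 1 :: (real ^ 'n) set)"
    using r content_cball[of r "0 :: real ^ 'n"] content_cball[of 1 "0 :: real ^ 'n"] by simp
  finally show ?thesis
    by (subst grid_discrepancy_coeff[OF M]) (simp add: card_grid[OF M])
qed

lemma grid_discrepancy_coeff_vanish:
  fixes k :: "int ^ 'n::finite"
  assumes M: "M > 0" and k: "\<not> int M dvd k $ i"
  shows "fourier_coeff (grid_discrepancy r M) k = 0"
  unfolding fourier_coeff_def
proof (rule torus_integral_char_vanish)
  let ?e = "(1 / real M) *\<^sub>R axis i 1 :: real ^ 'n"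
  have e: "axis i 1 \<in> (int_lattice :: (real ^ 'n) set)" by (auto simp: int_lattice_def axis_def)
  show "of_real (grid_discrepancy r M (x + ?e)) * fchar k (x + ?e)
      = fchar k ?e * (of_real (grid_discrepancy r M x) * fchar k x)" for x
    by (simp add: grid_discrepancy_grid_periodic[OF M e] fchar_add_right)
  show "fchar k ?e \<noteq> 1"
  proof
    assume "fchar k ?e = 1"
    then have "cos (2 * pi * (of_int (k $ i) / real M)) = 1"
      by (simp add: fchar_def inner_axis complex_eq_iff)
    then obtain j :: int where "2 * pi * (of_int (k $ i) / real M) = of_int j * 2 * pi"
      using cos_one_2pi_int by blast
    then have "real_of_int (k $ i) = of_int j * real M" using M by (simp add: field_simps)
    then have "real_of_int (k $ i) = real_of_int (j * int M)" by simp
    then have "k $ i = j * int M" by (simp only: of_int_eq_iff)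
    with k show False by simp
  qed
qed (auto simp: grid_discrepancy_periodic fchar_periodic)

text \<open>
  Only the frequencies \<open>k = Mm\<close> with \<open>m \<noteq> 0\<close> contribute, and the contribution of such a frequency is
  \<open>O(N\<^sup>2 \<bar>Mm\<bar>\<^sup>-\<^sup>d\<^sup>-\<^sup>1)\<close>.
\<close>

lemma grid_discrepancy_L2:
  assumes r: "0 < r" "r < 1 / 2"
  shows "\<exists>c>0. \<forall>M>0. (\<integral>t. (grid_discrepancy r M (t :: real ^ 'n::finite))\<^sup>2 \<partial>torus_lebesgue) \<le> c * real M ^ (CARD('n) - 1)"
proof -
  define d where "d = CARD('n)"
  have d: "d > 0" by (simp add: d_def)
  let ?F = "\<lambda>k :: int ^ 'n. norm (\<integral>x. indicator (cball 0 r) x *\<^sub>R cis (2 * pi * (of_int_vec k \<bullet> x)) \<partial>lborel)"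
  obtain C where C0: "C \<ge> 0" and dec: "\<forall>\<xi> :: real ^ 'n. \<xi> \<noteq> 0 \<longrightarrow>
      norm (\<integral>x. indicator (cball 0 r) x *\<^sub>R cis (2 * pi * (\<xi> \<bullet> x)) \<partial>lborel) \<le> C * norm \<xi> powr (- (real d + 1) / 2)"
    using ball_fourier_decay[OF r(1), where 'n = 'n] unfolding d_def by blast
  have C: "C \<ge> 0" "?F k \<le> C * norm (of_int_vec k) powr (- (real d + 1) / 2)" if "k \<noteq> 0" for k :: "int ^ 'n"
    using C0 dec[rule_format, of "of_int_vec k"] that by simp_all
  obtain A where A: "A \<ge> 0" "\<And>S :: (int ^ 'n) set. finite S \<Longrightarrow> 0 \<notin> S \<Longrightarrow> (\<Sum>k\<in>S. norm (of_int_vec k) powr (- (real d + 1))) \<le> A"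
    using int_vec_norm_powr_sums_bounded[where 'n = 'n] unfolding d_def by blast
  have main: "(\<integral>t. (grid_discrepancy r M (t :: real ^ 'n))\<^sup>2 \<partial>torus_lebesgue) \<le> (C\<^sup>2 * A) * real M ^ (d - 1)" if M: "M > 0" for M
  proof -
    let ?D = "grid_discrepancy r M :: real ^ 'n \<Rightarrow> real"
    define N where "N = real M ^ d"
    obtain B where B: "\<And>t. \<bar>?D t\<bar> \<le> B" using grid_discrepancy_bounded by blast
    have coeff: "(norm (fourier_coeff ?D k))\<^sup>2 \<le> N\<^sup>2 * C\<^sup>2 * norm (of_int_vec k) powr (- (real d + 1))" if k: "k \<noteq> 0" for k
    proof -
      have "norm (fourier_coeff ?D k) = norm (\<Sum>s\<in>(grid M :: (real ^ 'n) set). fchar k s) * ?F k"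
        using k by (simp add: grid_discrepancy_coeff[OF M] near_lattice_fourier[OF r(2)] norm_mult)
      also have "\<dots> \<le> N * (C * norm (of_int_vec k) powr (- (real d + 1) / 2))"
      proof (intro mult_mono C(2) k)
        show "norm (\<Sum>s\<in>(grid M :: (real ^ 'n) set). fchar k s) \<le> N"
          using norm_sum[of "fchar k" "grid M"] by (simp add: card_grid[OF M] N_def d_def)
      qed (simp_all add: N_def)
      finally have "(norm (fourier_coeff ?D k))\<^sup>2 \<le> (N * (C * norm (of_int_vec k) powr (- (real d + 1) / 2)))\<^sup>2"
        by (rule power_mono) simp
      also have "\<dots> = N\<^sup>2 * C\<^sup>2 * (norm (of_int_vec k) powr (- (real d + 1) / 2))\<^sup>2" by (simp add: power_mult_distrib)
      also have "(norm (of_int_vec k) powr (- (real d + 1) / 2))\<^sup>2 = norm (of_int_vec k) powr (- (real d + 1))"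
        by (simp add: power2_eq_square powr_add[symmetric])
      finally show ?thesis .
    qed
    \<comment> \<open>The sum over S is transported to the set of those nonzero m for which M m lies in S.\<close>
    have "(\<Sum>k\<in>S. (norm (fourier_coeff ?D k))\<^sup>2) \<le> (C\<^sup>2 * A) * real M ^ (d - 1)" if S: "finite S" for S
    proof -
      define S' where "S' = {m. (\<chi> i. int M * m $ i) \<in> S \<and> m \<noteq> 0}"
      let ?s = "\<lambda>m :: int ^ 'n. \<chi> i. int M * m $ i"
      have inj: "inj ?s" using M by (auto simp: inj_def vec_eq_iff)
      have S': "finite S'"
        using finite_vimageI[OF S inj] unfolding S'_def vimage_def by (rule rev_finite_subset) auto
      have nrm: "norm (of_int_vec (?s m)) = real M * norm (of_int_vec m)" for m
      proof -
        have "of_int_vec (?s m) = real M *\<^sub>R of_int_vec m" by (simp add: vec_eq_iff)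
        then show ?thesis by simp
      qed
      have "(\<Sum>k\<in>S. (norm (fourier_coeff ?D k))\<^sup>2) = (\<Sum>k\<in>?s ` S'. (norm (fourier_coeff ?D k))\<^sup>2)"
      proof (rule sum.mono_neutral_right[OF S])
        show "?s ` S' \<subseteq> S" by (auto simp: S'_def)
        show "\<forall>k\<in>S - ?s ` S'. (norm (fourier_coeff ?D k))\<^sup>2 = 0"
        proof
          fix k assume k: "k \<in> S - ?s ` S'"
          show "(norm (fourier_coeff ?D k))\<^sup>2 = 0"
          proof (cases "k = 0")
            case False
            have "\<exists>i. \<not> int M dvd k $ i"
            proof (rule ccontr)
              assume "\<nexists>i. \<not> int M dvd k $ i"
              moreover define q where "q = (\<chi> i. k $ i div int M)"
              ultimately have kq: "k = ?s q" by (simp add: vec_eq_iff)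
              have "q \<noteq> 0"
              proof
                assume "q = 0"
                with kq have "k = 0" by (simp add: vec_eq_iff)
                with False show False by simp
              qed
              then show False using k kq unfolding S'_def by blast
            qed
            then show ?thesis using grid_discrepancy_coeff_vanish[OF M] by auto
          qed (simp add: grid_discrepancy_coeff_0[OF M r])
        qed
      qed
      also have "\<dots> = (\<Sum>m\<in>S'. (norm (fourier_coeff ?D (?s m)))\<^sup>2)"
        using inj by (subst sum.reindex) (auto intro: inj_on_subset)
      also have "\<dots> \<le> (\<Sum>m\<in>S'. N\<^sup>2 * C\<^sup>2 * norm (of_int_vec (?s m)) powr (- (real d + 1)))"
        using M by (intro sum_mono coeff) (auto simp: S'_def vec_eq_iff)
      also have "\<dots> = N\<^sup>2 * C\<^sup>2 * real M powr (- (real d + 1)) * (\<Sum>m\<in>S'. norm (of_int_vec m) powr (- (real d + 1)))"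
        unfolding nrm by (simp add: powr_mult sum_distrib_left mult_ac)
      also have "\<dots> \<le> N\<^sup>2 * C\<^sup>2 * real M powr (- (real d + 1)) * A"
        using S' by (intro mult_left_mono A) (auto simp: S'_def)
      also have "N\<^sup>2 * C\<^sup>2 * real M powr (- (real d + 1)) * A = C\<^sup>2 * A * (N\<^sup>2 * real M powr (- (real d + 1)))" by simp
      also have "N\<^sup>2 * real M powr (- (real d + 1)) = real M ^ (d - 1)"
      proof -
        have "N\<^sup>2 * real M powr (- (real d + 1)) = real M powr (2 * real d) * real M powr (- (real d + 1))"
        proof -
          have "N\<^sup>2 = real M ^ (2 * d)" by (simp add: N_def power_mult[symmetric] mult.commute)
          also have "\<dots> = real M powr (2 * real d)" using M powr_realpow[of "real M" "2 * d"] by simp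
          finally show ?thesis by simp
        qed
        also have "\<dots> = real M powr (real (d - 1))"
          using d by (subst powr_add[symmetric]) (simp add: of_nat_diff)
        finally show ?thesis using M by (simp add: powr_realpow)
      qed
      finally show ?thesis .
    qed
    then show ?thesis
      by (intro fourier_norm_le[of ?D B] grid_discrepancy_measurable B grid_discrepancy_periodic grid_discrepancy_continuous_AE M)
  qed
  \<comment> \<open>The summand 1 makes the constant positive.\<close>
  have "(\<integral>t. (grid_discrepancy r M (t :: real ^ 'n))\<^sup>2 \<partial>torus_lebesgue) \<le> (C\<^sup>2 * A + 1) * real M ^ (d - 1)" if "M > 0" for M
    using main[OF that] by (rule order.trans) (simp add: mult_right_mono)
  then show ?thesis using A(1) unfolding d_def by (intro exI[of _ "C\<^sup>2 * A + 1"]) (auto simp: add_nonneg_pos)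
qed

lemma torus_translate_return:
  assumes "x \<in> torus"
  shows "torus_translate s (return torus_borel x) = return torus_borel (torus_rep (x - s))"
proof -
  have "(\<lambda>v. v - s) \<in> torus_borel \<rightarrow>\<^sub>M borel"
    unfolding torus_borel_def
    by (intro measurable_restrict_space1 borel_measurable_continuous_onI continuous_intros)
  then have "(\<lambda>v. torus_rep (v - s)) \<in> torus_borel \<rightarrow>\<^sub>M torus_borel"
    by (rule measurable_compose) (rule torus_rep_measurable)
  then show ?thesis unfolding torus_translate_def using assms by (intro distr_return) auto
qed

text \<open>
  The product of the unit masses is the unit mass at the family of the points \<open>- s\<close>. If the inner
  integral were not measurable as a function of the family, its integral would be zero by
  convention, so the inequality holds without an examination of measurability.
\<close>

lemma gen_discrepancy_return:
  assumes M: "M > 0"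
  shows "(gen_discrepancy r M (return torus_borel (0 :: real ^ 'n::finite)))\<^sup>2
     \<le> (\<integral>t. (grid_discrepancy r M (t :: real ^ 'n))\<^sup>2 \<partial>torus_lebesgue)"
proof -
  let ?G = "grid M :: (real ^ 'n) set"
  let ?P = "Pi\<^sub>M ?G (\<lambda>_. torus_borel :: (real ^ 'n) measure)"
  let ?V = "restrict (\<lambda>s. torus_rep (- s)) ?G"
  let ?H = "\<lambda>V. \<integral>t. (discrepancy r ?G V t)\<^sup>2 \<partial>torus_lebesgue"
  have fin: "finite ?G" by (rule finite_grid[OF M])
  have z: "(0 :: real ^ 'n) \<in> torus" by (simp add: torus_def)
  have sing: "{torus_rep x} \<in> sets torus_borel" for x :: "real ^ 'n"
    by (auto simp: torus_borel_def sets_restrict_space_iff torus_rep_in_torus)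
  have "Pi\<^sub>M ?G (\<lambda>s. torus_translate s (return torus_borel 0)) = Pi\<^sub>M ?G (\<lambda>s. return torus_borel (torus_rep (- s)))"
    by (simp add: torus_translate_return[OF z])
  also have "\<dots> = return ?P ?V" by (rule PiM_return[OF fin]) (rule sing)
  finally have "gen_discrepancy r M (return torus_borel (0 :: real ^ 'n)) = sqrt (\<integral>V. ?H V \<partial>return ?P ?V)"
    by (simp add: gen_discrepancy_def)
  moreover have "(\<integral>V. ?H V \<partial>return ?P ?V) \<le> ?H ?V"
  proof (cases "?H \<in> borel_measurable ?P")
    case True
    have "?V \<in> space ?P" by (auto simp: space_PiM torus_rep_in_torus)
    then show ?thesis using True by (subst integral_return) auto
  next
    case False
    then have "\<not> integrable (return ?P ?V) ?H" by (auto dest: borel_measurable_integrable)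
    then show ?thesis by (simp add: not_integrable_integral_eq)
  qed
  moreover have "0 \<le> (\<integral>V. ?H V \<partial>return ?P ?V)" by simp
  moreover have "discrepancy r ?G ?V = grid_discrepancy r M"
    unfolding grid_discrepancy_eq[symmetric] by (auto simp: discrepancy_def fun_eq_iff)
  ultimately show ?thesis by simp
qed

theorem proposition5:
  fixes r :: real and \<epsilon> :: "nat \<Rightarrow> real"
  assumes "CARD('n::finite) \<ge> 2"
    and "0 < r" and "r < 1 / 2"
    and "\<And>M. M \<ge> 2 \<Longrightarrow> 1 / real M < \<epsilon> M \<and> \<epsilon> M < 1"
  shows "\<exists>(\<mu> :: nat \<Rightarrow> (real ^ 'n) measure) (c :: real).
           0 < c \<and>
           (\<forall>M\<ge>2. torus_prob_measure (\<mu> M) \<and> supported_in_ball (\<epsilon> M) (\<mu> M) \<and>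
              (gen_discrepancy r M (\<mu> M))\<^sup>2
                \<le> c * real (M ^ CARD('n)) powr (1 - 1 / real CARD('n)))"
proof -
  obtain c where c: "c > 0" "\<And>M. M > 0 \<Longrightarrow>
      (\<integral>t. (grid_discrepancy r M (t :: real ^ 'n))\<^sup>2 \<partial>torus_lebesgue) \<le> c * real M ^ (CARD('n) - 1)"
    using grid_discrepancy_L2[OF assms(2,3), where 'n = 'n] by blast
  \<comment> \<open>The unit mass at the origin serves for every M, since it is supported in every ball around 0.\<close>
  define \<delta> where "\<delta> = return torus_borel (0 :: real ^ 'n)"
  have z: "(0 :: real ^ 'n) \<in> torus" by (simp add: torus_def)
  have prob: "torus_prob_measure \<delta>"
    unfolding torus_prob_measure_def \<delta>_def using z by (auto intro!: prob_space_return)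
  have supp: "supported_in_ball e \<delta>" if "e > 0" for e
  proof -
    have "{0 :: real ^ 'n} \<in> sets torus_borel"
      using z by (auto simp: torus_borel_def sets_restrict_space_iff)
    then have "AE v in \<delta>. v \<in> {0}" unfolding \<delta>_def using z by (subst AE_return) auto
    then have "AE v in \<delta>. v \<in> torus_ball 0 e"
    proof eventually_elim
      case (elim v)
      have "torus_rep (0 :: real ^ 'n) \<in> torus_ball 0 e"
        unfolding torus_ball_def using that by (intro imageI) simp
      then show ?case using elim torus_rep_id[OF z] by simp
    qed
    then show ?thesis unfolding supported_in_ball_def by blast
  qed
  have "(gen_discrepancy r M \<delta>)\<^sup>2 \<le> c * real (M ^ CARD('n)) powr (1 - 1 / real CARD('n))" if "M \<ge> 2" for M
  proof -
    have M: "M > 0" using that by simp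
    have "(gen_discrepancy r M \<delta>)\<^sup>2 \<le> c * real M ^ (CARD('n) - 1)"
      unfolding \<delta>_def using gen_discrepancy_return[OF M] c(2)[OF M] by (rule order.trans)
    also have "real M ^ (CARD('n) - 1) = real (M ^ CARD('n)) powr (1 - 1 / real CARD('n))"
    proof -
      have "real (M ^ CARD('n)) powr (1 - 1 / real CARD('n)) = real M powr (real CARD('n) * (1 - 1 / real CARD('n)))"
        using M by (simp add: powr_realpow[symmetric] powr_powr)
      also have "real CARD('n) * (1 - 1 / real CARD('n)) = real (CARD('n) - 1)"
        using assms(1) by (simp add: field_simps of_nat_diff)
      finally show ?thesis using M powr_realpow[of "real M" "CARD('n) - 1"] by simp
    qed
    finally show ?thesis .
  qed
  moreover have "0 < \<epsilon> M" if "M \<ge> 2" for M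
  proof -
    have "0 < 1 / real M" using that by simp
    also have "\<dots> < \<epsilon> M" using assms(4)[OF that] by blast
    finally show ?thesis .
  qed
  ultimately show ?thesis using prob supp c(1)
    by (intro exI[of _ "\<lambda>_. \<delta>"] exI[of _ c]) auto
qed

end
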